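(* Let $S=\{(3,5),(2,7),(2,8),(2,9),(2,10),(2,11)\}$, let $h,k$ be positive integers such that $(h,k)\in S$ or $(k,h)\in S$, put $m=h+k$, and let $R>0$. Let $$M_{kh}=\left\{(x,y)\in\mathbb{R}^k\times\mathbb{R}^h:\ \frac{|x|}{\sqrt{k-1}}=\frac{|y|}{\sqrt{h-1}}\right\}$$ and $$\lambda_{k,h}(R)=\inf\left\{\int_{M_{kh}}|\nabla^{M_{kh}}\varphi|^2-|\mathrm{II}_{M_{kh}}|^2\varphi^2\,d\mathcal{H}^{m-1}:\ \varphi\in C^1(M_{kh}),\ \int_{M_{kh}}\varphi^2\,d\mathcal{H}^{m-1}=1,\ \operatorname{spt}\varphi\subset\subset B_R^m\right\}.$$ Then $$\lambda_{k,h}(R)\ge\frac{c_{k,h}}{R^2},$$ where one may take $$c_{3,5}=c_{5,3}=\frac{\sqrt{3}}{21^3},\qquad c_{k,2}=c_{2,h}=\frac{\sqrt{11}}{11^6}\quad\text{for } k,h\in\{7,8,9,10,11\}.$$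
   Context: $\mathbb{R}^m$ is identified with $\mathbb{R}^k\times\mathbb{R}^h$, and $|\cdot|$ is the Euclidean norm. $B_R^m$ is the open ball of radius $R$ centered at the origin in $\mathbb{R}^m$. $\mathcal{H}^{m-1}$ is $(m-1)$-dimensional Hausdorff measure. $M_{kh}$ is a cone that is a smooth embedded hypersurface away from the origin; $\nabla^{M_{kh}}$ denotes the tangential gradient and $\mathrm{II}_{M_{kh}}$ the second fundamental form on $M_{kh}\setminus\{0\}$ (the origin is $\mathcal{H}^{m-1}$-null). $C^1(M_{kh})$ denotes the restrictions to $M_{kh}$ of $C^1$ functions on $\mathbb{R}^m$. $\operatorname{spt}\varphi$ is the support of $\varphi$, and $A\subset\subset B$ means that the closure of $A$ is compact and contained in $B$. *)

theory Defs
  imports "HOL-Analysis.Analysis"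
begin

section \<open>Hausdorff measure\<close>

text \<open>
  Covers are restricted to bounded sets because \<open>diameter\<close> is only meaningful on those.
  The constant \<open>unit_ball_vol s * (d / 2) powr s\<close> is the usual normalisation, for which
  the \<open>n\<close>-dimensional measure of \<open>\<real>\<^sup>n\<close> is Lebesgue measure. Since \<open>0 powr 0 = 0\<close>,
  the definition is intended for \<open>s > 0\<close> only.
\<close>

definition hausdorff_delta :: "real \<Rightarrow> real \<Rightarrow> 'a::metric_space set \<Rightarrow> ennreal" where
  "hausdorff_delta s \<delta> A =
     (INF C \<in> {C :: nat \<Rightarrow> 'a set. A \<subseteq> (\<Union>i. C i) \<and> (\<forall>i. bounded (C i) \<and> diameter (C i) \<le> \<delta>)}.
        \<Sum>i. ennreal (unit_ball_vol s * (diameter (C i) / 2) powr s))"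

definition hausdorff_outer :: "real \<Rightarrow> 'a::metric_space set \<Rightarrow> ennreal" where
  "hausdorff_outer s A = (SUP \<delta>\<in>{0<..}. hausdorff_delta s \<delta> A)"

definition hausdorff_measure :: "real \<Rightarrow> 'a::metric_space measure" where
  "hausdorff_measure s = measure_of UNIV (sets borel) (hausdorff_outer s)"

text \<open>
  \<open>measure_of\<close> silently yields the zero measure when its argument is not countably additive.
  The following facts show that this does not happen here: \<open>hausdorff_outer\<close> is a metric
  outer measure, so Caratheodory's criterion applies and \<open>hausdorff_measure s\<close> agrees with
  \<open>hausdorff_outer s\<close> on Borel sets.
\<close>

lemma hausdorff_delta_empty [simp]: "0 \<le> \<delta> \<Longrightarrow> hausdorff_delta s \<delta> {} = 0"
proof -
  assume "0 \<le> \<delta>"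
  then have "hausdorff_delta s \<delta> ({}::'a set)
      \<le> (\<Sum>i::nat. ennreal (unit_ball_vol s * (diameter ({}::'a set) / 2) powr s))"
    unfolding hausdorff_delta_def by (intro INF_lower) auto
  then show ?thesis by simp
qed

lemma hausdorff_delta_mono: "A \<subseteq> B \<Longrightarrow> hausdorff_delta s \<delta> A \<le> hausdorff_delta s \<delta> B"
  unfolding hausdorff_delta_def by (intro INF_superset_mono) auto

lemma hausdorff_delta_antimono:
  "\<delta> \<le> \<epsilon> \<Longrightarrow> hausdorff_delta s \<epsilon> A \<le> hausdorff_delta s \<delta> A"
  unfolding hausdorff_delta_def by (intro INF_superset_mono) (auto intro: order_trans)

lemma hausdorff_delta_UN:
  fixes A :: "nat \<Rightarrow> 'a::metric_space set"
  shows "hausdorff_delta s \<delta> (\<Union>i. A i) \<le> (\<Sum>i. hausdorff_delta s \<delta> (A i))"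
proof (rule ennreal_le_epsilon)
  fix e :: real
  assume e: "0 < e" and fin: "(\<Sum>n. hausdorff_delta s \<delta> (A n)) < top"
  let ?w = "\<lambda>C::'a set. ennreal (unit_ball_vol s * (diameter C / 2) powr s)"
  have lt: "hausdorff_delta s \<delta> (A n) < hausdorff_delta s \<delta> (A n) + e * (1/2)^Suc n" for n
    using e fin by (auto simp add: less_top dest!: ennreal_suminf_lessD)
  have "\<exists>C. A n \<subseteq> (\<Union>i. C i) \<and> (\<forall>i. bounded (C i) \<and> diameter (C i) \<le> \<delta>) \<and>
           (\<Sum>i. ?w (C i)) \<le> hausdorff_delta s \<delta> (A n) + e * (1/2)^Suc n" for n
    using lt[of n] unfolding hausdorff_delta_def[of _ _ "A n"] INF_less_iff
    by (auto intro: less_imp_le)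
  then obtain B where B: "\<And>n. A n \<subseteq> (\<Union>i. B n i)"
      "\<And>n i. bounded (B n i)" "\<And>n i. diameter (B n i) \<le> \<delta>"
      "\<And>n. (\<Sum>i. ?w (B n i)) \<le> hausdorff_delta s \<delta> (A n) + e * (1/2)^Suc n"
    by metis
  define C where "C = case_prod B \<circ> prod_decode"
  have "(\<Union>i. A i) \<subseteq> (\<Union>i. C i)"
    using B(1) by (auto simp add: C_def subset_eq) (metis prod.case prod_encode_inverse)
  then have "hausdorff_delta s \<delta> (\<Union>i. A i) \<le> (\<Sum>i. ?w (C i))"
    unfolding hausdorff_delta_def
    by (intro INF_lower) (auto simp: C_def split_def B)
  also have "\<dots> = (\<Sum>n. \<Sum>i. ?w (B n i))"
    using suminf_ennreal_2dimen[of "\<lambda>n. \<Sum>i. ?w (B n i)" "\<lambda>p. ?w (case_prod B p)"]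
    by (simp add: C_def)
  also have "\<dots> \<le> (\<Sum>n. hausdorff_delta s \<delta> (A n) + e * (1/2) ^ Suc n)"
    by (intro suminf_le allI B(4)) auto
  also have "\<dots> = (\<Sum>n. hausdorff_delta s \<delta> (A n)) + (\<Sum>n. ennreal e * ennreal ((1/2) ^ Suc n))"
    using e by (subst suminf_add[symmetric])
               (auto simp del: ennreal_suminf_cmult simp add: ennreal_mult[symmetric])
  also have "\<dots> = (\<Sum>n. hausdorff_delta s \<delta> (A n)) + e"
    unfolding ennreal_suminf_cmult
    by (subst suminf_ennreal_eq[OF zero_le_power power_half_series]) auto
  finally show "hausdorff_delta s \<delta> (\<Union>i. A i) \<le> (\<Sum>n. hausdorff_delta s \<delta> (A n)) + e" .
qed

lemma hausdorff_outer_mono: "A \<subseteq> B \<Longrightarrow> hausdorff_outer s A \<le> hausdorff_outer s B"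
  unfolding hausdorff_outer_def by (intro SUP_mono) (auto intro: hausdorff_delta_mono)

lemma hausdorff_outer_empty [simp]: "hausdorff_outer s {} = 0"
  unfolding hausdorff_outer_def by (auto intro!: SUP_eq_const[OF _ hausdorff_delta_empty])

lemma hausdorff_outer_UN:
  fixes A :: "nat \<Rightarrow> 'a::metric_space set"
  shows "hausdorff_outer s (\<Union>i. A i) \<le> (\<Sum>i. hausdorff_outer s (A i))"
  unfolding hausdorff_outer_def[of _ "\<Union>i. A i"]
proof (rule SUP_least)
  fix \<delta> :: real assume "\<delta> \<in> {0<..}"
  then have "(\<Sum>i. hausdorff_delta s \<delta> (A i)) \<le> (\<Sum>i. hausdorff_outer s (A i))"
    by (intro suminf_le) (auto simp: hausdorff_outer_def intro: SUP_upper)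
  with hausdorff_delta_UN[of s \<delta> A]
  show "hausdorff_delta s \<delta> (\<Union>i. A i) \<le> (\<Sum>i. hausdorff_outer s (A i))"
    by (rule order_trans)
qed

lemma outer_measure_space_hausdorff: "outer_measure_space (Pow UNIV) (hausdorff_outer s)"
  unfolding outer_measure_space_def
  by (auto simp: positive_def increasing_def countably_subadditive_def
      intro: hausdorff_outer_mono hausdorff_outer_UN)

lemma hausdorff_outer_Un: "hausdorff_outer s (A \<union> B) \<le> hausdorff_outer s A + hausdorff_outer s B"
proof -
  have sa: "subadditive (Pow UNIV) (hausdorff_outer s :: 'a set \<Rightarrow> _)"
    using outer_measure_space_hausdorff[of s]
    by (intro ring_of_sets.countably_subadditive_subadditive[OF ring_of_sets_Pow])
       (auto simp only: outer_measure_space_def)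
  have "hausdorff_outer s (A \<union> (B - A)) \<le> hausdorff_outer s A + hausdorff_outer s (B - A)"
    by (rule subadditiveD[OF sa]) auto
  also have "\<dots> \<le> hausdorff_outer s A + hausdorff_outer s B"
    by (intro add_left_mono hausdorff_outer_mono) auto
  finally show ?thesis by simp
qed

lemma hausdorff_outer_separated:
  assumes d: "0 < d" and sep: "\<And>x y. x \<in> A \<Longrightarrow> y \<in> B \<Longrightarrow> d \<le> dist x y"
  shows "hausdorff_outer s A + hausdorff_outer s B \<le> hausdorff_outer s (A \<union> B)"
proof -
  let ?w = "\<lambda>C::'a set. ennreal (unit_ball_vol s * (diameter C / 2) powr s)"
  have small: "hausdorff_delta s \<delta> A + hausdorff_delta s \<delta> B \<le> hausdorff_delta s \<delta> (A \<union> B)"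
    if \<delta>: "0 < \<delta>" "\<delta> < d" for \<delta>
    unfolding hausdorff_delta_def[of _ _ "A \<union> B"]
  proof (rule INF_greatest, clarify)
    fix C :: "nat \<Rightarrow> 'a set"
    assume cov: "A \<union> B \<subseteq> (\<Union>i. C i)" and C: "\<forall>i. bounded (C i) \<and> diameter (C i) \<le> \<delta>"
    define P where "P i = (if C i \<inter> A = {} then {} else C i)" for i
    define Q where "Q i = (if C i \<inter> B = {} then {} else C i)" for i
    have disj: "C i \<inter> A = {} \<or> C i \<inter> B = {}" for i
    proof (rule ccontr)
      assume "\<not> ?thesis"
      then obtain x y where "x \<in> C i" "x \<in> A" "y \<in> C i" "y \<in> B" by auto
      then have "d \<le> dist x y" "dist x y \<le> diameter (C i)"
        using sep C by (auto intro: diameter_bounded_bound)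
      with C \<delta> show False by (meson leD order_trans)
    qed
    have "hausdorff_delta s \<delta> A \<le> (\<Sum>i. ?w (P i))"
      unfolding hausdorff_delta_def using C cov \<delta>
      by (intro INF_lower) (fastforce simp: P_def)
    moreover have "hausdorff_delta s \<delta> B \<le> (\<Sum>i. ?w (Q i))"
      unfolding hausdorff_delta_def using C cov \<delta>
      by (intro INF_lower) (fastforce simp: Q_def)
    moreover have "(\<Sum>i. ?w (P i)) + (\<Sum>i. ?w (Q i)) = (\<Sum>i. ?w (P i) + ?w (Q i))"
      by (intro suminf_add) auto
    moreover have "\<dots> \<le> (\<Sum>i. ?w (C i))"
      using disj by (intro suminf_le) (auto simp: P_def Q_def)
    ultimately show "hausdorff_delta s \<delta> A + hausdorff_delta s \<delta> B \<le> (\<Sum>i. ?w (C i))"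
      by (metis (no_types, lifting) add_mono order_trans)
  qed
  have "hausdorff_delta s a A + hausdorff_delta s b B \<le> hausdorff_outer s (A \<union> B)"
    if "0 < a" "0 < b" for a b
  proof -
    define \<delta> where "\<delta> = min (min a b) (d / 2)"
    have \<delta>: "0 < \<delta>" "\<delta> < d" "\<delta> \<le> a" "\<delta> \<le> b" using that d by (auto simp: \<delta>_def)
    have "hausdorff_delta s a A + hausdorff_delta s b B
        \<le> hausdorff_delta s \<delta> A + hausdorff_delta s \<delta> B"
      by (intro add_mono hausdorff_delta_antimono \<delta>)
    also have "\<dots> \<le> hausdorff_delta s \<delta> (A \<union> B)" by (intro small \<delta>)
    also have "\<dots> \<le> hausdorff_outer s (A \<union> B)"
      unfolding hausdorff_outer_def using \<delta> by (intro SUP_upper) auto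
    finally show ?thesis .
  qed
  then have "(SUP b\<in>{0<..}. SUP a\<in>{0<..}. hausdorff_delta s a A + hausdorff_delta s b B)
      \<le> hausdorff_outer s (A \<union> B)"
    by (intro SUP_least) auto
  moreover have "(SUP b\<in>{0<..}. SUP a\<in>{0<..}. hausdorff_delta s a A + hausdorff_delta s b B)
      = hausdorff_outer s A + hausdorff_outer s B"
    unfolding hausdorff_outer_def
    by (subst ennreal_SUP_add_left; (subst ennreal_SUP_add_right)?) auto
  ultimately show ?thesis by simp
qed

lemma hausdorff_outer_separated_sum:
  fixes R :: "nat \<Rightarrow> 'a::metric_space set"
  assumes "\<And>N. \<exists>d>0. \<forall>j<N. \<forall>x\<in>R j. \<forall>y\<in>R N. d \<le> dist x y"
  shows "(\<Sum>j<N. hausdorff_outer s (R j)) \<le> hausdorff_outer s (\<Union>j<N. R j)"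
proof (induction N)
  case (Suc N)
  obtain d where d: "d > 0" "\<forall>j<N. \<forall>x\<in>R j. \<forall>y\<in>R N. d \<le> dist x y" using assms by blast
  have "(\<Sum>j<Suc N. hausdorff_outer s (R j)) \<le> hausdorff_outer s (\<Union>j<N. R j) + hausdorff_outer s (R N)"
    using Suc by (simp add: add_right_mono)
  also have "\<dots> \<le> hausdorff_outer s ((\<Union>j<N. R j) \<union> R N)"
    using d by (intro hausdorff_outer_separated[of d]) auto
  also have "(\<Union>j<N. R j) \<union> R N = (\<Union>j<Suc N. R j)"
    by (auto simp: less_Suc_eq)
  finally show ?case .
qed simp

lemma hausdorff_outer_closed:
  fixes F :: "'a::metric_space set"
  assumes F: "closed F"
  shows "hausdorff_outer s (X \<inter> F) + hausdorff_outer s (X - F) \<le> hausdorff_outer s X"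
proof (cases "F = {} \<or> hausdorff_outer s X = top")
  case True
  then show ?thesis by auto
next
  case False
  let ?H = "hausdorff_outer s"
  define R where "R j = {x\<in>X. 1 / (real j + 2) \<le> infdist x F \<and> infdist x F < 1 / (real j + 1)}" for j
  define Y where "Y n = {x\<in>X. 1 / (real n + 1) \<le> infdist x F}" for n
  have sepR: "\<exists>d>0. \<forall>j<N. \<forall>x\<in>R (2*j+p). \<forall>y\<in>R (2*N+p). d \<le> dist x y" for p N
  proof (intro exI conjI allI impI ballI)
    let ?d = "1 / (2 * real N + p + 1/2) - 1 / (2 * real N + p + 1)"
    show "0 < ?d" by (simp add: field_simps add_pos_nonneg)
    fix j x y assume j: "j < N" and x: "x \<in> R (2*j+p)" and y: "y \<in> R (2*N+p)"
    have "1 / (2 * real N + p + 1/2) \<le> 1 / (2 * real j + p + 2)"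
      using j by (intro divide_left_mono) (auto intro!: mult_pos_pos add_nonneg_pos)
    also have "\<dots> \<le> infdist x F" using x by (auto simp: R_def)
    finally show "?d \<le> dist x y"
      using y infdist_triangle[of x F y] by (auto simp: R_def)
  qed
  have half: "(\<Sum>j<N. ?H (R (2*j+p))) \<le> ?H X" for p N
    by (rule order_trans[OF hausdorff_outer_separated_sum[OF sepR]])
       (auto simp: R_def intro!: hausdorff_outer_mono)
  have split2: "(\<Sum>j<2*N. ?H (R j)) = (\<Sum>j<N. ?H (R (2*j+0))) + (\<Sum>j<N. ?H (R (2*j+1)))" for N
    by (induction N) (simp_all add: algebra_simps)
  have bound: "(\<Sum>j<N. ?H (R j)) \<le> ?H X + ?H X" for N
  proof -
    have "(\<Sum>j<N. ?H (R j)) \<le> (\<Sum>j<2*N. ?H (R j))" by (intro sum_mono2) auto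
    also have "\<dots> \<le> ?H X + ?H X" unfolding split2 by (intro add_mono half)
    finally show ?thesis .
  qed
  have "(\<Sum>j. ?H (R j)) \<le> ?H X + ?H X" by (intro suminf_le_const bound) auto
  then have fin: "(\<Sum>j. ?H (R j)) \<noteq> top"
    using False by (auto simp: top_unique)
  define b where "b j = enn2real (?H (R j))" for j
  have Hb: "?H (R j) = ennreal (b j)" for j
  proof -
    have "?H (R j) \<le> ?H X" by (intro hausdorff_outer_mono) (auto simp: R_def)
    then have "?H (R j) < top" using False by (auto simp: less_top intro: le_less_trans)
    then show ?thesis by (simp add: b_def)
  qed
  have b0: "0 \<le> b j" for j by (simp add: b_def)
  have sb: "summable b" using fin b0 by (intro summable_suminf_not_top) (auto simp: Hb)
  have far: "?H (X \<inter> F) + ?H (Y n) \<le> ?H X" for n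
  proof -
    have "?H (X \<inter> F) + ?H (Y n) \<le> ?H ((X \<inter> F) \<union> Y n)"
    proof (rule hausdorff_outer_separated[of "1 / (real n + 1)"])
      fix x y assume "x \<in> X \<inter> F" "y \<in> Y n"
      then show "1 / (real n + 1) \<le> dist x y"
        using infdist_le[of x F y] by (auto simp: Y_def dist_commute)
    qed simp
    also have "\<dots> \<le> ?H X" by (intro hausdorff_outer_mono) (auto simp: Y_def)
    finally show ?thesis .
  qed
  show ?thesis
  proof (rule ennreal_le_epsilon)
    fix e :: real assume "0 < e"
    then obtain n where n: "norm (\<Sum>i. b (i + n)) < e"
      using suminf_exist_split[OF _ sb] by blast
    have "X - F \<subseteq> Y n \<union> (\<Union>i. R (i + n))"
    proof
      fix x assume x: "x \<in> X - F"
      let ?t = "infdist x F"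
      have t: "0 < ?t" using x F False infdist_pos_not_in_closed[of F x] by auto
      show "x \<in> Y n \<union> (\<Union>i. R (i + n))"
      proof (cases "1 / (real n + 1) \<le> ?t")
        case True then show ?thesis using x by (auto simp: Y_def)
      next
        case small: False
        define k where "k = (LEAST k. 1 / (real k + 1) \<le> ?t)"
        have "\<exists>k. 1 / (real k + 1) \<le> ?t"
          using reals_Archimedean[OF t] by (auto simp: inverse_eq_divide add.commute intro: less_imp_le)
        then have k: "1 / (real k + 1) \<le> ?t" unfolding k_def by (rule LeastI_ex)
        have below: "\<not> 1 / (real j + 1) \<le> ?t" if "j < k" for j
          using that unfolding k_def by (rule not_less_Least)
        have "n < k"
        proof (rule ccontr)
          assume "\<not> n < k"
          then have "1 / (real n + 1) \<le> 1 / (real k + 1)" by (intro divide_left_mono) auto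
          with k small show False by linarith
        qed
        then obtain i where i: "k = Suc (i + n)"
          by (metis add.commute less_imp_Suc_add)
        have "x \<in> R (i + n)"
          using k below[of "i + n"] x unfolding R_def i by (auto simp: algebra_simps)
        then show ?thesis by blast
      qed
    qed
    then have "?H (X - F) \<le> ?H (Y n) + ?H (\<Union>i. R (i + n))"
      by (blast intro: order_trans hausdorff_outer_mono hausdorff_outer_Un)
    also have "\<dots> \<le> ?H (Y n) + (\<Sum>i. ?H (R (i + n)))"
      by (intro add_left_mono hausdorff_outer_UN)
    also have "(\<Sum>i. ?H (R (i + n))) = ennreal (\<Sum>i. b (i + n))"
      unfolding Hb using sb b0 by (intro suminf_ennreal2) (auto simp: summable_iff_shift)
    also have "?H (Y n) + ennreal (\<Sum>i. b (i + n)) \<le> ?H (Y n) + ennreal e"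
      using n by (intro add_left_mono ennreal_leI) auto
    finally have "?H (X \<inter> F) + ?H (X - F) \<le> (?H (X \<inter> F) + ?H (Y n)) + ennreal e"
      by (metis add.assoc add_left_mono)
    also have "\<dots> \<le> ?H X + ennreal e" by (intro add_right_mono far)
    finally show "?H (X \<inter> F) + ?H (X - F) \<le> ?H X + ennreal e" .
  qed
qed

lemma measure_space_hausdorff:
  "measure_space UNIV (sets (borel :: 'a::metric_space measure)) (hausdorff_outer s)"
proof -
  interpret sigma_algebra "UNIV :: 'a set" "Pow UNIV" by (rule sigma_algebra_Pow)
  let ?L = "lambda_system (UNIV :: 'a set) (Pow UNIV) (hausdorff_outer s)"
  have ms: "measure_space UNIV ?L (hausdorff_outer s)"
    by (rule caratheodory_lemma[OF outer_measure_space_hausdorff])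
  then have sa: "sigma_algebra UNIV ?L" by (simp add: measure_space_def)
  have closed_L: "closed F \<Longrightarrow> F \<in> ?L" for F :: "'a set"
    unfolding lambda_system_eq
    using hausdorff_outer_closed[of F s] hausdorff_outer_Un[of s "x \<inter> F" "x - F" for x]
    by (auto intro!: antisym simp: Int_Diff_Un)
  then have "sets (borel :: 'a measure) \<subseteq> ?L"
    unfolding borel_eq_closed
    using sigma_algebra.sigma_sets_subset[OF sa, of "Collect closed"] by auto
  then show ?thesis
    by (intro measure_down[OF ms]) (metis sets.sigma_algebra_axioms space_borel)
qed

lemma sets_hausdorff_measure [simp, measurable_cong]: "sets (hausdorff_measure s) = sets borel"
  unfolding hausdorff_measure_def by (metis sets.sets_measure_of_eq space_borel)

lemma space_hausdorff_measure [simp]: "space (hausdorff_measure s) = UNIV"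
  unfolding hausdorff_measure_def by (simp add: space_measure_of_conv)

lemma emeasure_hausdorff_measure:
  "A \<in> sets borel \<Longrightarrow> emeasure (hausdorff_measure s) A = hausdorff_outer s A"
  unfolding hausdorff_measure_def
  using measure_space_hausdorff[of s]
  by (intro emeasure_measure_of_sigma)
     (auto simp: measure_space_def)


section \<open>Geometry of embedded hypersurfaces\<close>

definition tangent_space :: "'a::euclidean_space set \<Rightarrow> 'a \<Rightarrow> 'a set" where
  "tangent_space M p =
     {v. \<exists>\<gamma> \<epsilon>. 0 < \<epsilon> \<and> \<gamma> C1_differentiable_on {-\<epsilon><..<\<epsilon>} \<and> (\<forall>t\<in>{-\<epsilon><..<\<epsilon>}. \<gamma> t \<in> M) \<and>
           \<gamma> 0 = p \<and> (\<gamma> has_vector_derivative v) (at 0)}"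

text \<open>
  A Frechet derivative within \<open>M\<close> is not unique as a linear map on the ambient space,
  but its values on tangent vectors are: they are the derivatives along curves in \<open>M\<close>.
  Below, \<open>frechet_derivative f (at p within M)\<close> is only applied to tangent vectors.
\<close>

definition tangential_gradient :: "'a::euclidean_space set \<Rightarrow> ('a \<Rightarrow> real) \<Rightarrow> 'a \<Rightarrow> 'a" where
  "tangential_gradient M \<phi> p =
     (THE v. v \<in> tangent_space M p \<and>
        (\<forall>u\<in>tangent_space M p. frechet_derivative \<phi> (at p within M) u = v \<bullet> u))"

definition local_unit_normal :: "'a::euclidean_space set \<Rightarrow> 'a \<Rightarrow> ('a \<Rightarrow> 'a) \<Rightarrow> bool" where
  "local_unit_normal M p \<nu> \<longleftrightarrow>
     (\<exists>U. open U \<and> p \<in> U \<and>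
        (\<forall>q\<in>M \<inter> U. norm (\<nu> q) = 1 \<and> (\<forall>v\<in>tangent_space M q. \<nu> q \<bullet> v = 0) \<and>
                   \<nu> differentiable (at q within M)))"

text \<open>
  The vector-valued second fundamental form \<open>II(u, v) = - \<langle>D\<^sub>u \<nu>, v\<rangle> \<nu>\<close>. It is unchanged when
  \<open>\<nu>\<close> is replaced by \<open>-\<nu>\<close>, so the choice of the local unit normal does not matter.
\<close>

definition second_fundamental_form :: "'a::euclidean_space set \<Rightarrow> 'a \<Rightarrow> 'a \<Rightarrow> 'a \<Rightarrow> 'a" where
  "second_fundamental_form M p u v =
     (let \<nu> = (SOME \<nu>. local_unit_normal M p \<nu>)
      in - (frechet_derivative \<nu> (at p within M) u \<bullet> v) *\<^sub>R \<nu> p)"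

definition orthonormal_basis_of :: "'a::euclidean_space set \<Rightarrow> 'a set \<Rightarrow> bool" where
  "orthonormal_basis_of V B \<longleftrightarrow>
     pairwise orthogonal B \<and> (\<forall>b\<in>B. norm b = 1) \<and> B \<subseteq> V \<and> span B = V"

text \<open>The squared Hilbert-Schmidt norm, which does not depend on the orthonormal basis.\<close>

definition second_fundamental_form_norm_sq :: "'a::euclidean_space set \<Rightarrow> 'a \<Rightarrow> real" where
  "second_fundamental_form_norm_sq M p =
     (let B = (SOME B. orthonormal_basis_of (tangent_space M p) B)
      in \<Sum>u\<in>B. \<Sum>v\<in>B. (norm (second_fundamental_form M p u v))\<^sup>2)"


section \<open>The Dirichlet problem for the Jacobi operator\<close>

definition hypersurface_integral :: "'a::euclidean_space set \<Rightarrow> ('a \<Rightarrow> real) \<Rightarrow> real" where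
  "hypersurface_integral M f = (LINT x:M|hausdorff_measure (real DIM('a) - 1). f x)"

text \<open>
  Restrictions to \<open>M\<close> of \<open>C\<^sup>1\<close> functions on the whole space. Values outside \<open>M\<close> are
  irrelevant to everything below.
\<close>

definition C1_restrictions :: "'a::euclidean_space set \<Rightarrow> ('a \<Rightarrow> real) set" where
  "C1_restrictions M =
     {\<phi>. \<exists>\<Phi> D. (\<forall>x. GDERIV \<Phi> x :> D x) \<and> continuous_on UNIV D \<and> (\<forall>x\<in>M. \<phi> x = \<Phi> x)}"

definition support_in :: "'a::euclidean_space set \<Rightarrow> ('a \<Rightarrow> real) \<Rightarrow> 'a set" where
  "support_in M \<phi> = M \<inter> closure {x\<in>M. \<phi> x \<noteq> 0}"

definition compactly_contained :: "'a::topological_space set \<Rightarrow> 'a set \<Rightarrow> bool" where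
  "compactly_contained A B \<longleftrightarrow> compact (closure A) \<and> closure A \<subseteq> B"

definition stability_form :: "'a::euclidean_space set \<Rightarrow> ('a \<Rightarrow> real) \<Rightarrow> real" where
  "stability_form M \<phi> =
     hypersurface_integral M (\<lambda>x. (norm (tangential_gradient M \<phi> x))\<^sup>2
                                  - second_fundamental_form_norm_sq M x * (\<phi> x)\<^sup>2)"

text \<open>
  The infimum is taken in the extended reals, so that it is meaningful without knowing
  beforehand that the stability form is bounded below on the admissible functions.
\<close>

definition first_eigenvalue :: "'a::euclidean_space set \<Rightarrow> real \<Rightarrow> ereal" where
  "first_eigenvalue M R =
     (INF \<phi> \<in> {\<phi> \<in> C1_restrictions M. hypersurface_integral M (\<lambda>x. (\<phi> x)\<^sup>2) = 1 \<and>
                  compactly_contained (support_in M \<phi>) (ball 0 R)}.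
        ereal (stability_form M \<phi>))"


section \<open>Lawson cones\<close>

text \<open>
  \<open>k = CARD('k)\<close> and \<open>h = CARD('h)\<close>. The norm of the product type is the Euclidean norm of
  \<open>\<real>\<^sup>k\<^sup>+\<^sup>h\<close>.
\<close>

definition lawson_cone :: "((real^'k) \<times> (real^'h)) set" where
  "lawson_cone = {(x, y). norm x / sqrt (real CARD('k) - 1) = norm y / sqrt (real CARD('h) - 1)}"

definition admissible_pairs :: "(nat \<times> nat) set" where
  "admissible_pairs = {(3, 5), (2, 7), (2, 8), (2, 9), (2, 10), (2, 11)}"

text \<open>Only meant for \<open>(k, h)\<close> or \<open>(h, k)\<close> in \<open>admissible_pairs\<close>.\<close>

definition stability_const :: "nat \<Rightarrow> nat \<Rightarrow> real" where
  "stability_const k h =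
     (if (k, h) = (3, 5) \<or> (k, h) = (5, 3) then sqrt 3 / 21 ^ 3 else sqrt 11 / 11 ^ 6)"

end

theory Submission
  imports Defs
begin

text \<open>
  Write \<open>m = h + k\<close> and \<open>n = m - 1\<close> for the dimensions of the space and of the cone \<open>M\<close>. The cone is minimal, and a point \<open>p \<noteq> 0\<close> of it
  satisfies \<open>|II|\<^sup>2 = (m - 2) / |p|\<^sup>2\<close>. The bound therefore follows from Hardy's inequality on \<open>M\<close>,
  \<open>((n - 2) / 2)\<^sup>2 \<integral>\<^sub>M \<phi>\<^sup>2 / |p|\<^sup>2 \<le> \<integral>\<^sub>M |\<nabla>\<phi>|\<^sup>2\<close>:
  the stability form is at least \<open>c \<integral>\<^sub>M \<phi>\<^sup>2 / |p|\<^sup>2\<close> with \<open>c = ((m - 3) / 2)\<^sup>2 - (m - 2)\<close>, hence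
  at least \<open>c / R\<^sup>2\<close> if \<open>\<phi>\<close> is normalised and supported in the ball of radius \<open>R\<close>. As
  \<open>4 c = (m - 5)\<^sup>2 - 8\<close>, we have \<open>c \<ge> 1 / 4\<close> as soon as \<open>m \<ge> 8\<close>, which holds for all
  admissible pairs, and \<open>1 / 4\<close> is much more than the constants that are claimed.

  Hardy's inequality needs only two properties of the Hausdorff measure on \<open>M\<close>: it is homogeneous of
  degree \<open>n\<close> under dilations, and it is finite on balls. Differentiating the homogeneity
  \<open>\<integral> g(t p) = t\<^sup>-\<^sup>n \<integral> g(p)\<close> at \<open>t = 1\<close> gives the divergence theorem for the radial field,
  \<open>\<integral> p \<bullet> \<nabla>g = - n \<integral> g\<close> (\<open>integral_radial_derivative\<close>). It is applied to
  \<open>g = \<phi>\<^sup>2 / (|p|\<^sup>2 + \<epsilon>)\<close>, followed by Young's inequality (\<open>regularised_hardy\<close>) and by monotone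
  convergence as \<open>\<epsilon>\<close> tends to \<open>0\<close>, which also shows that \<open>\<phi>\<^sup>2 / |p|\<^sup>2\<close> is integrable (\<open>hardy\<close>). Only
  the radial derivative of \<open>\<phi>\<close> enters, so no area formula and no integration by parts on \<open>M\<close> is used.

  Homogeneity is immediate from the definition of the Hausdorff measure. For finiteness on balls,
  \<open>M\<close> is cut into finitely many pieces that are Lipschitz graphs over coordinate hyperplanes
  (\<open>hausdorff_outer_quad_cone_cball_finite\<close>). The geometric quantities are computed from the global
  unit normal \<open>\<nu>(p) = S p / |p|\<close> of \<open>M - {0}\<close>, where \<open>S\<close> is a self-adjoint linear map with
  \<open>M = {p. S p \<bullet> p = 0}\<close>: the tangent spaces (\<open>tangent_space_quad_cone\<close>), the second fundamental form
  (\<open>second_fundamental_form_norm_sq_quad_cone\<close>) and the tangential gradient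
  (\<open>tangential_gradient_quad_cone\<close>).
\<close>

section \<open>Hausdorff measure, dilations and Lipschitz graphs\<close>

lemma hausdorff_outer_scaleR_le:
  fixes A :: "'a::real_normed_vector set"
  assumes "0 < c" and "0 \<le> s"
  shows "hausdorff_outer s ((*\<^sub>R) c ` A) \<le> ennreal (c powr s) * hausdorff_outer s A"
  unfolding hausdorff_outer_def[of _ "(*\<^sub>R) c ` A"]
proof (rule SUP_least)
  fix \<delta> :: real assume \<delta>: "\<delta> \<in> {0<..}"
  let ?w = "\<lambda>C::'a set. ennreal (unit_ball_vol s * (diameter C / 2) powr s)"
  have diam: "diameter ((*\<^sub>R) c ` X) \<le> c * diameter X" if "bounded X" for X :: "'a set"
  proof (rule diameter_le)
    show "(*\<^sub>R) c ` X \<noteq> {} \<or> 0 \<le> c * diameter X"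
      using that assms by (simp add: diameter_ge_0)
    show "norm (x - y) \<le> c * diameter X" if xy: "x \<in> (*\<^sub>R) c ` X" "y \<in> (*\<^sub>R) c ` X" for x y
    proof -
      from xy obtain u v where uv: "u \<in> X" "v \<in> X" "x = c *\<^sub>R u" "y = c *\<^sub>R v" by auto
      then have "norm (u - v) \<le> diameter X"
        using diameter_bounded_bound[OF \<open>bounded X\<close>] by (simp add: dist_norm)
      then show ?thesis
        using uv assms by (simp add: scaleR_diff_right[symmetric])
    qed
  qed
  have "hausdorff_delta s \<delta> ((*\<^sub>R) c ` A) \<le> ennreal (c powr s) * hausdorff_delta s (\<delta> / c) A"
  proof -
    have "hausdorff_delta s \<delta> ((*\<^sub>R) c ` A) \<le> ennreal (c powr s) * (\<Sum>i. ?w (C i))"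
      if C: "A \<subseteq> (\<Union>i. C i)" "\<forall>i. bounded (C i) \<and> diameter (C i) \<le> \<delta> / c"
      for C :: "nat \<Rightarrow> 'a set"
    proof -
      have dC: "diameter ((*\<^sub>R) c ` C i) \<le> c * diameter (C i)" for i
        using C by (intro diam) auto
      have "hausdorff_delta s \<delta> ((*\<^sub>R) c ` A) \<le> (\<Sum>i. ?w ((*\<^sub>R) c ` C i))"
        unfolding hausdorff_delta_def
      proof (intro INF_lower CollectI conjI allI)
        show "(*\<^sub>R) c ` A \<subseteq> (\<Union>i. (*\<^sub>R) c ` C i)"
          using image_mono[OF C(1), of "(*\<^sub>R) c"] by (simp add: image_UN)
        show "bounded ((*\<^sub>R) c ` C i)" for i using C by (simp add: bounded_scaling)
        have "c * diameter (C i) \<le> \<delta>" for i using C assms by (simp add: field_simps)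
        then show "diameter ((*\<^sub>R) c ` C i) \<le> \<delta>" for i using dC[of i] by (meson order_trans)
      qed
      also have "\<dots> \<le> (\<Sum>i. ennreal (c powr s) * ?w (C i))"
      proof (intro suminf_le allI)
        fix i
        have "0 \<le> diameter (C i)" "0 \<le> diameter ((*\<^sub>R) c ` C i)"
          using C by (simp_all add: diameter_ge_0 bounded_scaling)
        then have "(diameter ((*\<^sub>R) c ` C i) / 2) powr s \<le> (c * (diameter (C i) / 2)) powr s"
          using dC[of i] assms by (intro powr_mono2) auto
        also have "\<dots> = c powr s * (diameter (C i) / 2) powr s"
          by (rule powr_mult)
        finally have "unit_ball_vol s * (diameter ((*\<^sub>R) c ` C i) / 2) powr s
            \<le> c powr s * (unit_ball_vol s * (diameter (C i) / 2) powr s)"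
          using unit_ball_vol_nonneg[OF \<open>0 \<le> s\<close>]
          by (metis mult.left_commute mult_left_mono)
        then show "?w ((*\<^sub>R) c ` C i) \<le> ennreal (c powr s) * ?w (C i)"
          by (simp add: ennreal_mult'[symmetric] ennreal_leI)
      qed simp_all
      finally show ?thesis by simp
    qed
    note le = this
    have cancel: "ennreal (c powr s) * (ennreal (c powr - s) * z) = z" for z
    proof -
      have "c powr s * c powr - s = 1" using assms by (simp add: powr_minus)
      then show ?thesis
        by (simp add: mult.assoc[symmetric] ennreal_mult'[symmetric] )
    qed
    have cancel': "ennreal (c powr - s) * (ennreal (c powr s) * z) = z" for z
      using cancel[of z] by (simp add: mult.left_commute)
    have "ennreal (c powr - s) * hausdorff_delta s \<delta> ((*\<^sub>R) c ` A) \<le> hausdorff_delta s (\<delta> / c) A"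
      unfolding hausdorff_delta_def[of _ _ A]
    proof (rule INF_greatest, clarify)
      fix C :: "nat \<Rightarrow> 'a set"
      assume "A \<subseteq> (\<Union>i. C i)" "\<forall>i. bounded (C i) \<and> diameter (C i) \<le> \<delta> / c"
      from mult_left_mono[OF le[OF this], of "ennreal (c powr - s)"]
      show "ennreal (c powr - s) * hausdorff_delta s \<delta> ((*\<^sub>R) c ` A) \<le> (\<Sum>i. ?w (C i))"
        by (simp only: cancel' zero_le)
    qed
    from mult_left_mono[OF this, of "ennreal (c powr s)"] show ?thesis by (simp only: cancel zero_le)
  qed
  also have "\<dots> \<le> ennreal (c powr s) * hausdorff_outer s A"
    using \<delta> assms by (intro mult_left_mono) (auto simp: hausdorff_outer_def intro!: SUP_upper)
  finally show "hausdorff_delta s \<delta> ((*\<^sub>R) c ` A) \<le> ennreal (c powr s) * hausdorff_outer s A" .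
qed

lemma hausdorff_outer_scaleR:
  fixes A :: "'a::real_normed_vector set"
  assumes c: "0 < c" and s: "0 \<le> s"
  shows "hausdorff_outer s ((*\<^sub>R) c ` A) = ennreal (c powr s) * hausdorff_outer s A"
proof (rule antisym[OF hausdorff_outer_scaleR_le[OF assms]])
  have "A = (*\<^sub>R) (inverse c) ` ((*\<^sub>R) c ` A)"
    using c by (auto simp: image_image)
  then have "hausdorff_outer s A
      \<le> ennreal (inverse c powr s) * hausdorff_outer s ((*\<^sub>R) c ` A)"
    using hausdorff_outer_scaleR_le[of "inverse c" s "(*\<^sub>R) c ` A"] assms by simp
  from mult_left_mono[OF this, of "ennreal (c powr s)"]
  have "ennreal (c powr s) * hausdorff_outer s A
      \<le> ennreal (c powr s * inverse c powr s) * hausdorff_outer s ((*\<^sub>R) c ` A)"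
    by (simp add: mult.assoc[symmetric] ennreal_mult'[symmetric])
  also have "c powr s * inverse c powr s = 1"
    using c by (simp add: powr_mult[symmetric])
  finally show "ennreal (c powr s) * hausdorff_outer s A \<le> hausdorff_outer s ((*\<^sub>R) c ` A)"
    by simp
qed

lemma hausdorff_outer_singleton:
  assumes "0 < s"
  shows "hausdorff_outer s {a} = 0"
proof -
  have "hausdorff_delta s \<delta> {a} \<le> 0" if "0 < \<delta>" for \<delta>
  proof -
    have "hausdorff_delta s \<delta> {a}
        \<le> (\<Sum>i::nat. ennreal (unit_ball_vol s * (diameter {a} / 2) powr s))"
      unfolding hausdorff_delta_def using that by (intro INF_lower) auto
    then show ?thesis by simp
  qed
  then show ?thesis
    unfolding hausdorff_outer_def by (intro antisym SUP_least) auto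
qed

lemma hausdorff_delta_finite_cover_le:
  fixes A :: "'a::metric_space set"
  assumes "0 \<le> s" "finite I" and cover: "A \<subseteq> (\<Union>i\<in>I. C i)"
    and "\<And>i. i \<in> I \<Longrightarrow> bounded (C i)"
    and diam: "\<And>i. i \<in> I \<Longrightarrow> diameter (C i) \<le> d" and "0 \<le> d" "d \<le> \<delta>"
  shows "hausdorff_delta s \<delta> A \<le> ennreal (real (card I) * (unit_ball_vol s * (d / 2) powr s))"
proof -
  from ex_bij_betw_nat_finite[OF \<open>finite I\<close>] obtain e where e: "bij_betw e {0..<card I} I" by blast
  define B where "B j = (if j < card I then C (e j) else {})" for j
  have eI: "e j \<in> I" if "j < card I" for j using e that by (auto simp: bij_betw_def)
  have "hausdorff_delta s \<delta> A \<le> (\<Sum>j. ennreal (unit_ball_vol s * (diameter (B j) / 2) powr s))"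
    unfolding hausdorff_delta_def
  proof (intro INF_lower CollectI conjI allI)
    show "A \<subseteq> (\<Union>j. B j)"
    proof
      fix x assume "x \<in> A"
      then obtain i where i: "i \<in> I" "x \<in> C i" using cover by auto
      then obtain j where "j < card I" "e j = i"
        using e by (metis atLeastLessThan_iff bij_betw_iff_bijections)
      then show "x \<in> (\<Union>j. B j)" using i by (auto simp: B_def)
    qed
    show "bounded (B j)" for j using assms eI by (simp add: B_def)
    show "diameter (B j) \<le> \<delta>" for j
      using diam[OF eI, of j] \<open>0 \<le> d\<close> \<open>d \<le> \<delta>\<close> by (auto simp: B_def)
  qed
  also have "\<dots> = (\<Sum>j<card I. ennreal (unit_ball_vol s * (diameter (B j) / 2) powr s))"
    by (rule suminf_finite) (auto simp: B_def)
  also have "\<dots> \<le> (\<Sum>j<card I. ennreal (unit_ball_vol s * (d / 2) powr s))"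
  proof (intro sum_mono ennreal_leI mult_left_mono powr_mono2)
    fix j assume "j \<in> {..<card I}"
    then show "diameter (B j) / 2 \<le> d / 2" "0 \<le> diameter (B j) / 2"
      using diam[OF eI, of j] assms(4)[OF eI, of j] by (auto simp: B_def diameter_ge_0)
  qed (use assms in auto)
  also have "\<dots> = ennreal (real (card I) * (unit_ball_vol s * (d / 2) powr s))"
    using assms by (simp add: ennreal_mult' ennreal_of_nat_eq_real_of_nat)
  finally show ?thesis .
qed

text \<open>
  The hypothesis on \<open>A\<close> says that a point of \<open>A\<close> is a Lipschitz function of its coordinates other
  than the one in direction \<open>b\<close>. Cutting the coordinate hyperplane into cubes of side \<open>1 / N\<close> covers
  \<open>A\<close> by about \<open>N\<^sup>m\<close> sets of diameter at most \<open>L / N\<close>, where \<open>m\<close> is the dimension of the hyperplane,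
  so the covering sums stay bounded as \<open>N\<close> grows.
\<close>

lemma hausdorff_outer_lipschitz_graph_finite:
  fixes A :: "'a::euclidean_space set"
  assumes A: "bounded A" and b: "b \<in> Basis"
    and L: "\<And>p q d. p \<in> A \<Longrightarrow> q \<in> A \<Longrightarrow> (\<And>i. i \<in> Basis - {b} \<Longrightarrow> \<bar>(p - q) \<bullet> i\<bar> \<le> d) \<Longrightarrow> 0 < d
              \<Longrightarrow> norm (p - q) \<le> L * d"
    and "0 \<le> L"
  shows "hausdorff_outer (real DIM('a) - 1) A < top"
proof -
  obtain K0 where K0: "\<And>p. p \<in> A \<Longrightarrow> norm p \<le> K0" using A by (auto simp: bounded_iff)
  define K where "K = nat \<lceil>\<bar>K0\<bar>\<rceil> + 1"
  have K: "\<bar>p \<bullet> i\<bar> < real K" if "p \<in> A" "i \<in> Basis" for p i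
    using K0[OF that(1)] Basis_le_norm[OF that(2), of p] unfolding K_def by linarith
  define s where "s = real DIM('a) - 1"
  define m where "m = DIM('a) - 1"
  have s: "s = real m" "0 \<le> s" using DIM_positive[where 'a='a] by (auto simp: s_def m_def of_nat_diff Suc_leI)
  have card: "card (Basis - {b}) = m" using b by (simp add: m_def)
  define V where "V = unit_ball_vol s * (real K * L) powr s"
  have le: "hausdorff_delta s \<delta> A \<le> ennreal V" if "0 < \<delta>" for \<delta>
  proof -
    obtain N0 where N0: "L / \<delta> < real N0" using reals_Archimedean2 by blast
    define N where "N = Suc N0"
    have N: "N > 0" "L / N \<le> \<delta>"
      using N0 that unfolding N_def by (auto simp: field_simps intro: order_trans)
    define I where "I = (Basis - {b}) \<rightarrow>\<^sub>E {- int (K * N)..<int (K * N)}"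
    define C where "C z = {p\<in>A. \<forall>i\<in>Basis - {b}. \<lfloor>(p \<bullet> i) * N\<rfloor> = z i}" for z
    have fin: "finite I" unfolding I_def by (intro finite_PiE) auto
    have "nat (int (K * N) - - int (K * N)) = 2 * K * N" by (simp add: nat_mult_distrib)
    then have cI: "card I = (2 * K * N) ^ m"
      unfolding I_def by (simp only: card_PiE finite_Diff finite_Basis prod_constant card card_atLeastLessThan_int)
    have "hausdorff_delta s \<delta> A \<le> ennreal (real (card I) * (unit_ball_vol s * (L / N / 2) powr s))"
    proof (rule hausdorff_delta_finite_cover_le[OF s(2) fin])
      show "A \<subseteq> (\<Union>z\<in>I. C z)"
      proof
        fix p assume p: "p \<in> A"
        define z where "z = (\<lambda>i\<in>Basis - {b}. \<lfloor>(p \<bullet> i) * N\<rfloor>)"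
        have "z \<in> I" unfolding I_def
        proof (rule PiE_I)
          fix i assume i: "i \<in> Basis - {b}"
          have "\<bar>(p \<bullet> i) * N\<bar> < real K * real N"
            using K[OF p, of i] i N by (simp add: abs_mult)
          then have "- (real K * N) \<le> (p \<bullet> i) * N" "(p \<bullet> i) * N < real K * N" by linarith+
          then have "- int (K * N) \<le> \<lfloor>(p \<bullet> i) * N\<rfloor>" "\<lfloor>(p \<bullet> i) * N\<rfloor> < int (K * N)"
            by (simp_all add: le_floor_iff floor_less_iff)
          then show "z i \<in> {- int (K * N)..<int (K * N)}" using i by (simp add: z_def)
        qed (auto simp: z_def)
        moreover have "p \<in> C z" using p by (simp add: C_def z_def)
        ultimately show "p \<in> (\<Union>z\<in>I. C z)" by blast
      qed
      show "bounded (C z)" for z using A by (rule bounded_subset) (auto simp: C_def)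
      show "diameter (C z) \<le> L / N" for z
      proof (rule diameter_le)
        show "C z \<noteq> {} \<or> 0 \<le> L / N" using \<open>0 \<le> L\<close> by simp
        fix p q assume pq: "p \<in> C z" "q \<in> C z"
        have "\<bar>(p - q) \<bullet> i\<bar> \<le> 1 / N" if i: "i \<in> Basis - {b}" for i
        proof -
          have "\<lfloor>(p \<bullet> i) * N\<rfloor> = \<lfloor>(q \<bullet> i) * N\<rfloor>" using pq i by (auto simp: C_def)
          then have "\<bar>(p \<bullet> i) * N - (q \<bullet> i) * N\<bar> \<le> 1" by linarith
          then have "\<bar>(p - q) \<bullet> i\<bar> * N \<le> 1"
            by (simp add: inner_diff_left left_diff_distrib[symmetric] abs_mult)
          then show ?thesis using N by (simp add: field_simps)
        qed
        from L[OF _ _ this] pq N show "norm (p - q) \<le> L / N" by (auto simp: C_def)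
      qed
    qed (use N \<open>0 \<le> L\<close> in auto)
    also have "real (card I) * (unit_ball_vol s * (L / N / 2) powr s) = V"
    proof -
      have "real (card I) = (2 * real K * real N) powr s"
      proof -
        have "0 < K" by (simp add: K_def)
        then have "0 < 2 * real K * real N" using N by simp
        then show ?thesis by (simp add: cI s powr_realpow)
      qed
      then have "real (card I) * (L / N / 2) powr s = (2 * real K * real N * (L / N / 2)) powr s"
        using N \<open>0 \<le> L\<close> by (simp only: powr_mult)
      also have "2 * real K * real N * (L / N / 2) = real K * L" using N by simp
      finally show ?thesis unfolding V_def by (simp add: mult.left_commute)
    qed
    finally show ?thesis .
  qed
  have "hausdorff_outer s A \<le> ennreal V"
    unfolding hausdorff_outer_def using le by (intro SUP_least) auto
  then show ?thesis by (auto simp: s_def less_top[symmetric] top_unique)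
qed

lemma hausdorff_outer_UN_finite_less_top:
  assumes "finite I" "\<And>i. i \<in> I \<Longrightarrow> hausdorff_outer s (A i) < top"
  shows "hausdorff_outer s (\<Union>i\<in>I. A i) < top"
  using assms
proof (induction I)
  case (insert i I)
  have "hausdorff_outer s (\<Union>j\<in>insert i I. A j) \<le> hausdorff_outer s (A i) + hausdorff_outer s (\<Union>j\<in>I. A j)"
    using hausdorff_outer_Un by simp
  also have "\<dots> < top" using insert by simp
  finally show ?case .
qed simp

section \<open>Hardy inequality for homogeneous measures on cones\<close>

text \<open>
  A measure that lives on a cone (its space), is homogeneous of degree \<open>n\<close> under dilations and is
  finite on balls. The cone carries the trace of the Borel sigma-algebra.
\<close>

locale cone_measure =
  fixes \<mu> :: "'a::euclidean_space measure" and n :: real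
  assumes sets_eq: "sets \<mu> = sets (restrict_space borel (space \<mu>))"
    and cone: "x \<in> space \<mu> \<Longrightarrow> 0 < t \<Longrightarrow> t *\<^sub>R x \<in> space \<mu>"
    and homogeneous: "0 < t \<Longrightarrow> A \<in> sets \<mu> \<Longrightarrow>
      emeasure \<mu> ((*\<^sub>R) t ` A) = ennreal (t powr n) * emeasure \<mu> A"
    and finite_on_balls: "emeasure \<mu> (space \<mu> \<inter> cball 0 r) < top"
begin

lemma measurable_cone:
  "f \<in> borel_measurable borel \<Longrightarrow> f \<in> borel_measurable \<mu>"
  by (subst measurable_cong_sets[OF sets_eq refl]) (rule measurable_restrict_space1)

lemma measurable_scaleR_cone:
  assumes "0 < t"
  shows "(*\<^sub>R) t \<in> measurable \<mu> \<mu>"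
proof -
  have "(*\<^sub>R) t \<in> measurable \<mu> borel" by (rule measurable_cone) simp
  then have "(*\<^sub>R) t \<in> measurable \<mu> (restrict_space borel (space \<mu>))"
    by (rule measurable_restrict_space2[rotated]) (use assms in \<open>blast intro: cone\<close>)
  then show ?thesis by (simp add: measurable_cong_sets[OF refl sets_eq])
qed

lemma distr_scaleR:
  assumes t: "0 < t"
  shows "distr \<mu> \<mu> ((*\<^sub>R) t) = density \<mu> (\<lambda>_. ennreal (t powr - n))"
proof (rule measure_eqI)
  fix A assume "A \<in> sets (distr \<mu> \<mu> ((*\<^sub>R) t))"
  then have A: "A \<in> sets \<mu>" by simp
  have "(*\<^sub>R) t -` A \<inter> space \<mu> = (*\<^sub>R) (inverse t) ` A"
  proof (intro set_eqI iffI)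
    fix x assume "x \<in> (*\<^sub>R) t -` A \<inter> space \<mu>"
    moreover have "x = inverse t *\<^sub>R (t *\<^sub>R x)" using t by simp
    ultimately show "x \<in> (*\<^sub>R) (inverse t) ` A" by blast
  next
    fix x assume "x \<in> (*\<^sub>R) (inverse t) ` A"
    then obtain y where "y \<in> A" "x = inverse t *\<^sub>R y" by blast
    then show "x \<in> (*\<^sub>R) t -` A \<inter> space \<mu>"
      using cone[of y "inverse t"] sets.sets_into_space[OF A] t by auto
  qed
  moreover have "inverse t powr n = t powr - n"
    using t by (simp add: powr_def ln_inverse)
  ultimately show "emeasure (distr \<mu> \<mu> ((*\<^sub>R) t)) A = emeasure (density \<mu> (\<lambda>_. ennreal (t powr - n))) A"
    using A t by (simp add: emeasure_distr measurable_scaleR_cone emeasure_density_const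
        homogeneous)
qed simp

lemma integral_scaleR:
  fixes f :: "'a \<Rightarrow> real"
  assumes t: "0 < t" and f: "f \<in> borel_measurable \<mu>"
  shows "(\<integral>x. f (t *\<^sub>R x) \<partial>\<mu>) = t powr - n * (\<integral>x. f x \<partial>\<mu>)"
proof -
  have "(\<integral>x. f (t *\<^sub>R x) \<partial>\<mu>) = integral\<^sup>L (distr \<mu> \<mu> ((*\<^sub>R) t)) f"
    using f by (simp add: integral_distr measurable_scaleR_cone t)
  also have "\<dots> = t powr - n * (\<integral>x. f x \<partial>\<mu>)"
    unfolding distr_scaleR[OF t] using f by (subst integral_density) auto
  finally show ?thesis .
qed

lemma integrable_bounded_support:
  fixes f :: "'a \<Rightarrow> real"
  assumes "f \<in> borel_measurable \<mu>"
    and "\<And>x. x \<in> space \<mu> \<Longrightarrow> r < norm x \<Longrightarrow> f x = 0"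
    and "\<And>x. x \<in> space \<mu> \<Longrightarrow> norm x \<le> r \<Longrightarrow> \<bar>f x\<bar> \<le> C"
  shows "integrable \<mu> f"
proof (rule integrableI_bounded_set[where A = "space \<mu> \<inter> cball 0 r" and B = C])
  show "space \<mu> \<inter> cball 0 r \<in> sets \<mu>"
    unfolding sets_eq by (simp add: sets_restrict_space)
  show "emeasure \<mu> (space \<mu> \<inter> cball 0 r) < \<infinity>" using finite_on_balls by simp
  show "AE x in \<mu>. x \<in> space \<mu> \<inter> cball 0 r \<longrightarrow> norm (f x) \<le> C"
    using assms by auto
  show "AE x in \<mu>. x \<notin> space \<mu> \<inter> cball 0 r \<longrightarrow> f x = 0"
    using assms(2) by (intro AE_I2) auto
qed fact

text \<open>
  Here \<open>G\<close> is the radial derivative \<open>x \<bullet> \<nabla>g(x)\<close>. The difference quotients of \<open>t \<mapsto> g (t x)\<close> at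
  \<open>t = 1\<close> are integrated in two ways, by dominated convergence and by homogeneity. Taking \<open>t > 1\<close>
  only keeps them supported in the ball of radius \<open>r\<close>.
\<close>

lemma integral_radial_derivative:
  fixes g G :: "'a \<Rightarrow> real"
  assumes g: "continuous_on UNIV g" and G: "continuous_on UNIV G"
    and deriv: "\<And>x t. 0 < t \<Longrightarrow> ((\<lambda>t. g (t *\<^sub>R x)) has_real_derivative G (t *\<^sub>R x) / t) (at t)"
    and supp: "\<And>x. x \<in> space \<mu> \<Longrightarrow> r \<le> norm x \<Longrightarrow> g x = 0"
  shows "(\<integral>x. G x \<partial>\<mu>) = - n * (\<integral>x. g x \<partial>\<mu>)"
proof -
  have [measurable]: "g \<in> borel_measurable borel" "G \<in> borel_measurable borel"
    using g G by (auto intro: borel_measurable_continuous_onI)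
  have "compact (G ` cball 0 (2 * r))"
    using G by (intro compact_continuous_image continuous_on_subset[OF G]) auto
  then obtain C where C: "0 < C" "\<And>x. norm x \<le> 2 * r \<Longrightarrow> \<bar>G x\<bar> \<le> C"
    by (auto dest!: compact_imp_bounded simp: bounded_pos)
  have "compact (g ` cball 0 r)"
    using g by (intro compact_continuous_image continuous_on_subset[OF g]) auto
  then obtain C' where "\<forall>x\<in>cball 0 r. \<bar>g x\<bar> \<le> C'"
    by (auto dest!: compact_imp_bounded simp: bounded_iff)
  then have C': "\<And>x. norm x \<le> r \<Longrightarrow> \<bar>g x\<bar> \<le> C'" by simp
  have int_g: "integrable \<mu> g"
    by (rule integrable_bounded_support[of _ r C']) (use supp C' in \<open>auto intro!: measurable_cone\<close>)
  define \<tau> where "\<tau> j = 1 + inverse (real (Suc j))" for j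
  have \<tau>: "1 < \<tau> j" "\<tau> j \<le> 2" for j by (auto simp: \<tau>_def field_simps)
  have "\<tau> \<longlonglongrightarrow> 1"
    using LIMSEQ_inverse_real_of_nat_add[of 1] by (simp add: \<tau>_def[abs_def])
  then have \<tau>_lim: "filterlim \<tau> (at 1) sequentially"
    unfolding filterlim_at using \<tau>(1) by (auto simp: less_imp_neq[symmetric])
  define q where "q j x = (g (\<tau> j *\<^sub>R x) - g x) / (\<tau> j - 1)" for j x
  have [measurable]: "q j \<in> borel_measurable borel" for j unfolding q_def by measurable
  have q_lim: "(\<lambda>j. q j x) \<longlonglongrightarrow> G x" for x
  proof -
    have "((\<lambda>t. (g (t *\<^sub>R x) - g (1 *\<^sub>R x)) / (t - 1)) \<longlongrightarrow> G x) (at 1)"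
      using deriv[of 1 x] by (simp add: has_field_derivative_iff)
    from filterlim_compose[OF this \<tau>_lim] show ?thesis by (simp add: q_def)
  qed
  have q_bound: "\<bar>q j x\<bar> \<le> indicator (cball 0 r) x * C" if x: "x \<in> space \<mu>" for j x
  proof (cases "norm x < r")
    case True
    have "\<exists>z>1. z < \<tau> j \<and> g (\<tau> j *\<^sub>R x) - g (1 *\<^sub>R x) = (\<tau> j - 1) * (G (z *\<^sub>R x) / z)"
      using \<tau>(1)[of j] by (intro MVT2 deriv) auto
    then obtain z where z: "1 < z" "z < \<tau> j" "q j x = G (z *\<^sub>R x) / z"
      using \<tau>(1)[of j] by (auto simp: q_def)
    have "norm (z *\<^sub>R x) \<le> 2 * r"
      using z \<tau>(2)[of j] True by (simp add: mult_mono)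
    then have "\<bar>G (z *\<^sub>R x)\<bar> \<le> C" by (rule C)
    moreover have "\<bar>G (z *\<^sub>R x)\<bar> / z \<le> \<bar>G (z *\<^sub>R x)\<bar>" using z by (simp add: divide_le_eq mult_le_cancel_left1)
    ultimately show ?thesis using True z by (simp add: abs_divide)
  next
    case False
    have "r \<le> norm (\<tau> j *\<^sub>R x)"
      using False \<tau>(1)[of j] mult_right_mono[of 1 "\<tau> j" "norm x"] by simp
    then have "q j x = 0" using supp cone x False \<tau>(1)[of j] by (simp add: q_def)
    then show ?thesis using C by (simp add: indicator_def)
  qed
  have "(\<lambda>j. \<integral>x. q j x \<partial>\<mu>) \<longlonglongrightarrow> (\<integral>x. G x \<partial>\<mu>)"
  proof (rule integral_dominated_convergence[where w = "\<lambda>x. indicator (cball 0 r) x * C"])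
    show "integrable \<mu> (\<lambda>x. indicator (cball 0 r) x * C)"
      by (rule integrable_bounded_support[of _ r C]) (use C in \<open>auto intro!: measurable_cone simp: indicator_def\<close>)
    show "AE x in \<mu>. norm (q j x) \<le> indicator (cball 0 r) x * C" for j
      using q_bound by (intro AE_I2) simp
  qed (auto intro!: AE_I2 q_lim measurable_cone)
  moreover have "(\<integral>x. q j x \<partial>\<mu>) = (\<tau> j powr - n - 1) / (\<tau> j - 1) * (\<integral>x. g x \<partial>\<mu>)" for j
  proof -
    have "\<tau> j > 0" using \<tau>(1)[of j] by simp
    have int: "integrable \<mu> (\<lambda>x. g (\<tau> j *\<^sub>R x))"
    proof (rule integrable_bounded_support[of _ r C'])
      fix x assume x: "x \<in> space \<mu>"
      have le: "norm x \<le> norm (\<tau> j *\<^sub>R x)"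
        using \<tau>(1)[of j] mult_right_mono[of 1 "\<tau> j" "norm x"] by simp
      have cx: "\<tau> j *\<^sub>R x \<in> space \<mu>" using x cone \<open>\<tau> j > 0\<close> by blast
      show "g (\<tau> j *\<^sub>R x) = 0" if "r < norm x" using supp[OF cx] le that by simp
      show "\<bar>g (\<tau> j *\<^sub>R x)\<bar> \<le> C'" if "norm x \<le> r"
        using supp[OF cx] C'[of "\<tau> j *\<^sub>R x"] C'[of x] that by (cases "norm (\<tau> j *\<^sub>R x) \<le> r") auto
    qed (rule measurable_cone, measurable)
    have "(\<integral>x. q j x \<partial>\<mu>) = ((\<integral>x. g (\<tau> j *\<^sub>R x) \<partial>\<mu>) - (\<integral>x. g x \<partial>\<mu>)) / (\<tau> j - 1)"
      unfolding q_def using int int_g by simp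
    also have "\<dots> = (\<tau> j powr - n - 1) / (\<tau> j - 1) * (\<integral>x. g x \<partial>\<mu>)"
      using \<open>\<tau> j > 0\<close> by (simp add: integral_scaleR measurable_cone left_diff_distrib)
    finally show ?thesis .
  qed
  moreover have "(\<lambda>j. (\<tau> j powr - n - 1) / (\<tau> j - 1) * (\<integral>x. g x \<partial>\<mu>)) \<longlonglongrightarrow> - n * (\<integral>x. g x \<partial>\<mu>)"
  proof (intro tendsto_intros)
    have "((\<lambda>t. t powr - n) has_real_derivative - n) (at 1)"
      by (auto intro!: derivative_eq_intros)
    then have "((\<lambda>t::real. (t powr - n - 1) / (t - 1)) \<longlongrightarrow> - n) (at 1)"
      by (simp add: has_field_derivative_iff)
    from filterlim_compose[OF this \<tau>_lim]
    show "(\<lambda>j. (\<tau> j powr - n - 1) / (\<tau> j - 1)) \<longlonglongrightarrow> - n" .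
  qed
  ultimately show ?thesis using LIMSEQ_unique by simp
qed

text \<open>
  \<open>D\<close> is the gradient of \<open>\<Phi>\<close>, and \<open>W\<close> is any nonnegative integrable majorant of the squared radial derivative of
  \<open>\<Phi>\<close>; below it is the square of the tangential gradient. Only the values of \<open>\<Phi>\<close> on the cone are
  assumed to have bounded support.
\<close>

lemma regularised_hardy:
  fixes \<Phi> :: "'a \<Rightarrow> real" and D :: "'a \<Rightarrow> 'a"
  assumes n: "2 < n" and \<epsilon>: "0 < \<epsilon>"
    and \<Phi>: "\<And>x. GDERIV \<Phi> x :> D x" and D: "continuous_on UNIV D"
    and supp: "\<And>x. x \<in> space \<mu> \<Longrightarrow> r \<le> norm x \<Longrightarrow> \<Phi> x = 0"
    and W: "integrable \<mu> W" "\<And>x. x \<in> space \<mu> \<Longrightarrow> 0 \<le> W x"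
      "\<And>x. x \<in> space \<mu> \<Longrightarrow> (D x \<bullet> x)\<^sup>2 \<le> (norm x)\<^sup>2 * W x"
  shows "integrable \<mu> (\<lambda>x. (\<Phi> x)\<^sup>2 / ((norm x)\<^sup>2 + \<epsilon>))"
    and "((n - 2) / 2)\<^sup>2 * (\<integral>x. (\<Phi> x)\<^sup>2 / ((norm x)\<^sup>2 + \<epsilon>) \<partial>\<mu>) \<le> (\<integral>x. W x \<partial>\<mu>)"
proof -
  define w where "w x = (norm x)\<^sup>2 + \<epsilon>" for x :: 'a
  have w: "0 < w x" for x using \<epsilon> by (simp add: w_def add_nonneg_pos)
  define g where "g x = (\<Phi> x)\<^sup>2 / w x" for x
  define G where "G x = 2 * \<Phi> x * (D x \<bullet> x) / w x - 2 * (norm x)\<^sup>2 * (\<Phi> x)\<^sup>2 / (w x)\<^sup>2" for x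
  define a where "a = (n - 2) / 2"
  have a: "0 < a" "n = 2 * a + 2" using n by (simp_all add: a_def field_simps)
  have [continuous_intros]: "continuous_on UNIV \<Phi>"
    using \<Phi> by (intro continuous_at_imp_continuous_on) (auto simp: gderiv_def intro: has_derivative_continuous)
  have w_cont [continuous_intros]: "continuous_on UNIV w"
    unfolding w_def by (intro continuous_intros)
  have g_cont: "continuous_on UNIV g"
    unfolding g_def using w by (intro continuous_intros) (auto simp: less_imp_neq[symmetric])
  have G_cont: "continuous_on UNIV G"
    unfolding G_def using w D by (intro continuous_intros) (auto simp: less_imp_neq[symmetric])
  have deriv: "((\<lambda>t. g (t *\<^sub>R x)) has_real_derivative G (t *\<^sub>R x) / t) (at t)" if t: "0 < t" for x t
  proof -
    have "((\<lambda>t. \<Phi> (t *\<^sub>R x)) has_derivative (\<lambda>h. (h *\<^sub>R x) \<bullet> D (t *\<^sub>R x))) (at t)"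
      using \<Phi>[of "t *\<^sub>R x", unfolded gderiv_def]
      by (rule has_derivative_compose[rotated]) (auto intro!: derivative_eq_intros)
    then have 1: "((\<lambda>t. \<Phi> (t *\<^sub>R x)) has_real_derivative (x \<bullet> D (t *\<^sub>R x))) (at t)"
      by (simp add: has_field_derivative_def mult.commute[of _ "x \<bullet> D (t *\<^sub>R x)"])
    have w_eq: "w (s *\<^sub>R x) = s\<^sup>2 * (norm x)\<^sup>2 + \<epsilon>" for s
      by (simp add: w_def power_mult_distrib)
    have 2: "((\<lambda>t. w (t *\<^sub>R x)) has_real_derivative (2 * t * (norm x)\<^sup>2)) (at t)"
      unfolding w_eq by (auto intro!: derivative_eq_intros)
    have 3: "((\<lambda>t. (\<Phi> (t *\<^sub>R x))\<^sup>2) has_real_derivative 2 * \<Phi> (t *\<^sub>R x) * (x \<bullet> D (t *\<^sub>R x))) (at t)"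
      by (auto intro!: derivative_eq_intros 1)
    have nz: "w (t *\<^sub>R x) \<noteq> 0" using w[of "t *\<^sub>R x"] by simp
    have "(2 * \<Phi> (t *\<^sub>R x) * (x \<bullet> D (t *\<^sub>R x)) * w (t *\<^sub>R x) - (\<Phi> (t *\<^sub>R x))\<^sup>2 * (2 * t * (norm x)\<^sup>2))
        / (w (t *\<^sub>R x) * w (t *\<^sub>R x)) = G (t *\<^sub>R x) / t"
      using t nz by (simp add: G_def field_simps power2_eq_square inner_commute)
    with DERIV_divide[OF 3 2 nz] show ?thesis unfolding g_def by simp
  qed
  have meas: "g \<in> borel_measurable \<mu>" "G \<in> borel_measurable \<mu>"
    using g_cont G_cont by (auto intro!: measurable_cone borel_measurable_continuous_onI)
  have "compact (g ` cball 0 r)"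
    by (intro compact_continuous_image continuous_on_subset[OF g_cont]) auto
  then obtain C where C: "\<forall>x\<in>cball 0 r. \<bar>g x\<bar> \<le> C"
    by (auto dest!: compact_imp_bounded simp: bounded_iff)
  have int_g: "integrable \<mu> g"
    by (rule integrable_bounded_support[of _ r C]) (use C supp meas in \<open>auto simp: g_def\<close>)
  then show "integrable \<mu> (\<lambda>x. (\<Phi> x)\<^sup>2 / ((norm x)\<^sup>2 + \<epsilon>))"
    by (simp add: g_def[abs_def] w_def)
  have euler: "(\<integral>x. G x \<partial>\<mu>) = - n * (\<integral>x. g x \<partial>\<mu>)"
    using supp by (intro integral_radial_derivative[of g G r] g_cont G_cont deriv) (auto simp: g_def)
  have point: "- G x \<le> (a + 2) * g x + W x / a" if x: "x \<in> space \<mu>" for x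
  proof -
    \<comment> \<open>Young's inequality; the weight \<open>a\<close> is the optimal one\<close>
    have "0 \<le> (a * \<Phi> x + D x \<bullet> x)\<^sup>2 / (a * w x)" using a w[of x] by simp
    also have "\<dots> = a * g x + 2 * \<Phi> x * (D x \<bullet> x) / w x + (D x \<bullet> x)\<^sup>2 / w x / a"
      using a(1) w[of x] by (simp add: g_def field_simps power2_eq_square)
    also have "(D x \<bullet> x)\<^sup>2 / w x \<le> W x"
    proof -
      have "(D x \<bullet> x)\<^sup>2 \<le> w x * W x"
        using W(3)[OF x] W(2)[OF x] \<epsilon> by (simp add: w_def distrib_right add_increasing2)
      then show ?thesis using w[of x] by (simp add: divide_le_eq mult.commute)
    qed
    finally have "- (2 * \<Phi> x * (D x \<bullet> x) / w x) \<le> a * g x + W x / a"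
      using a(1) by (simp add: divide_right_mono)
    moreover have "2 * (norm x)\<^sup>2 * (\<Phi> x)\<^sup>2 / (w x)\<^sup>2 \<le> 2 * g x"
    proof -
      have "2 * (norm x)\<^sup>2 * (\<Phi> x)\<^sup>2 / (w x)\<^sup>2 = 2 * g x * ((norm x)\<^sup>2 / w x)"
        by (simp add: g_def power2_eq_square)
      also have "\<dots> \<le> 2 * g x * 1"
        using w[of x] \<epsilon> by (intro mult_left_mono) (auto simp: g_def w_def)
      finally show ?thesis by simp
    qed
    ultimately show ?thesis unfolding G_def by (simp add: algebra_simps)
  qed
  have "n * (\<integral>x. g x \<partial>\<mu>) = (\<integral>x. - G x \<partial>\<mu>)" using euler by simp
  also have "\<dots> \<le> (\<integral>x. (a + 2) * g x + W x / a \<partial>\<mu>)"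
  proof (rule integral_mono')
    show "integrable \<mu> (\<lambda>x. (a + 2) * g x + W x / a)" using int_g W(1) by simp
    show "0 \<le> (a + 2) * g x + W x / a" if "x \<in> space \<mu>" for x
      using a W(2)[OF that] w[of x] by (simp add: g_def)
  qed (rule point)
  also have "\<dots> = (a + 2) * (\<integral>x. g x \<partial>\<mu>) + (\<integral>x. W x \<partial>\<mu>) / a"
    using int_g W(1) by simp
  finally have "a * (\<integral>x. g x \<partial>\<mu>) \<le> (\<integral>x. W x \<partial>\<mu>) / a"
    unfolding a(2) by (simp add: algebra_simps)
  then have "a\<^sup>2 * (\<integral>x. g x \<partial>\<mu>) \<le> (\<integral>x. W x \<partial>\<mu>)"
    using a(1) by (simp add: le_divide_eq power2_eq_square mult_ac)
  then show "((n - 2) / 2)\<^sup>2 * (\<integral>x. (\<Phi> x)\<^sup>2 / ((norm x)\<^sup>2 + \<epsilon>) \<partial>\<mu>) \<le> (\<integral>x. W x \<partial>\<mu>)"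
    by (simp add: a_def g_def w_def)
qed

text \<open>
  The origin has to be a null set, since the quotient \<open>(\<Phi> 0)\<^sup>2 / 0\<close>, which is \<open>0\<close>, is not the limit of
  the regularised quotients there.
\<close>

lemma hardy:
  fixes \<Phi> :: "'a \<Rightarrow> real" and D :: "'a \<Rightarrow> 'a"
  assumes n: "2 < n" and null: "AE x in \<mu>. x \<noteq> 0"
    and \<Phi>: "\<And>x. GDERIV \<Phi> x :> D x" and D: "continuous_on UNIV D"
    and supp: "\<And>x. x \<in> space \<mu> \<Longrightarrow> r \<le> norm x \<Longrightarrow> \<Phi> x = 0"
    and W: "integrable \<mu> W" "\<And>x. x \<in> space \<mu> \<Longrightarrow> 0 \<le> W x"
      "\<And>x. x \<in> space \<mu> \<Longrightarrow> (D x \<bullet> x)\<^sup>2 \<le> (norm x)\<^sup>2 * W x"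
  shows "integrable \<mu> (\<lambda>x. (\<Phi> x)\<^sup>2 / (norm x)\<^sup>2)"
    and "((n - 2) / 2)\<^sup>2 * (\<integral>x. (\<Phi> x)\<^sup>2 / (norm x)\<^sup>2 \<partial>\<mu>) \<le> (\<integral>x. W x \<partial>\<mu>)"
proof -
  define \<epsilon> where "\<epsilon> i = inverse (real (Suc i))" for i
  have \<epsilon>: "0 < \<epsilon> i" for i by (simp add: \<epsilon>_def)
  have \<epsilon>_lim: "\<epsilon> \<longlonglongrightarrow> 0"
    using LIMSEQ_inverse_real_of_nat by (simp add: \<epsilon>_def[abs_def])
  define f where "f i x = (\<Phi> x)\<^sup>2 / ((norm x)\<^sup>2 + \<epsilon> i)" for i x
  note reg = regularised_hardy[where r = r, OF n \<epsilon> \<Phi> D supp W, folded f_def]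
  define c where "c = ((n - 2) / 2)\<^sup>2"
  have c: "0 < c" using n by (simp add: c_def)
  have pos: "0 < (norm x)\<^sup>2 + \<epsilon> i" for x :: 'a and i using \<epsilon>[of i] by (simp add: add_nonneg_pos)
  have mono: "incseq (\<lambda>i. f i x)" for x
  proof (rule incseq_SucI)
    fix i
    have "\<epsilon> (Suc i) \<le> \<epsilon> i" by (simp add: \<epsilon>_def field_simps)
    then show "f i x \<le> f (Suc i) x"
      unfolding f_def using pos[of x] by (intro divide_left_mono mult_pos_pos) auto
  qed
  have lim: "(\<lambda>i. f i x) \<longlonglongrightarrow> (\<Phi> x)\<^sup>2 / (norm x)\<^sup>2" if "x \<noteq> 0" for x
  proof -
    have "(\<lambda>i. (\<Phi> x)\<^sup>2 / ((norm x)\<^sup>2 + \<epsilon> i)) \<longlonglongrightarrow> (\<Phi> x)\<^sup>2 / ((norm x)\<^sup>2 + 0)"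
      using that by (intro tendsto_intros \<epsilon>_lim) auto
    then show ?thesis by (simp add: f_def)
  qed
  have bound: "(\<integral>x. f i x \<partial>\<mu>) \<le> (\<integral>x. W x \<partial>\<mu>) / c" for i
    using reg(2)[of i] c by (simp add: le_divide_eq c_def mult.commute)
  have "incseq (\<lambda>i. \<integral>x. f i x \<partial>\<mu>)"
    using mono reg(1) by (auto intro!: incseq_SucI integral_mono dest: incseq_SucD)
  from incseq_convergent[OF this] bound obtain L
    where L: "(\<lambda>i. \<integral>x. f i x \<partial>\<mu>) \<longlonglongrightarrow> L" by blast
  have "continuous_on UNIV \<Phi>"
    using \<Phi> by (intro continuous_at_imp_continuous_on) (auto simp: gderiv_def intro: has_derivative_continuous)
  then have [measurable]: "\<Phi> \<in> borel_measurable borel" by (rule borel_measurable_continuous_onI)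
  have meas: "(\<lambda>x. (\<Phi> x)\<^sup>2 / (norm x)\<^sup>2) \<in> borel_measurable \<mu>"
    by (rule measurable_cone) measurable
  have ae: "AE x in \<mu>. (\<lambda>i. f i x) \<longlonglongrightarrow> (\<Phi> x)\<^sup>2 / (norm x)\<^sup>2"
    using null by eventually_elim (rule lim)
  have ae_mono: "AE x in \<mu>. mono (\<lambda>i. f i x)" using mono by simp
  show "integrable \<mu> (\<lambda>x. (\<Phi> x)\<^sup>2 / (norm x)\<^sup>2)"
    by (rule integrable_monotone_convergence[OF reg(1) ae_mono ae L meas])
  have "(\<integral>x. (\<Phi> x)\<^sup>2 / (norm x)\<^sup>2 \<partial>\<mu>) = L"
    by (rule integral_monotone_convergence[OF reg(1) ae_mono ae L meas])
  also have "L \<le> (\<integral>x. W x \<partial>\<mu>) / c"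
    using L bound by (intro LIMSEQ_le_const2) auto
  finally show "((n - 2) / 2)\<^sup>2 * (\<integral>x. (\<Phi> x)\<^sup>2 / (norm x)\<^sup>2 \<partial>\<mu>) \<le> (\<integral>x. W x \<partial>\<mu>)"
    using c by (simp add: le_divide_eq c_def mult.commute)
qed

end

section \<open>Tangent vectors and orthonormal frames\<close>

text \<open>
  A derivative within \<open>M\<close> need not be unique, but its values on tangent vectors are the derivatives
  along curves in \<open>M\<close>.
\<close>

lemma has_derivative_within_tangent_unique:
  assumes f1: "(f has_derivative f1) (at p within M)" and f2: "(f has_derivative f2) (at p within M)"
    and u: "u \<in> tangent_space M p"
  shows "f1 u = f2 u"
proof -
  obtain c \<epsilon> where c: "0 < \<epsilon>" "\<forall>t\<in>{-\<epsilon><..<\<epsilon>}. c t \<in> M" "c 0 = p"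
      "(c has_vector_derivative u) (at 0)"
    using u unfolding tangent_space_def by blast
  let ?I = "{-\<epsilon><..<\<epsilon>}"
  have at: "at 0 within ?I = at 0" using c by (intro at_within_open) auto
  have chain: "(f \<circ> c has_derivative (g \<circ> (\<lambda>h. h *\<^sub>R u))) (at 0)"
    if "(f has_derivative g) (at p within M)" for g
  proof -
    have "(c has_derivative (\<lambda>h. h *\<^sub>R u)) (at 0 within ?I)"
      using c(4) by (simp add: at has_vector_derivative_def)
    moreover have "(f has_derivative g) (at (c 0) within c ` ?I)"
      using that c by (auto intro: has_derivative_subset)
    ultimately show ?thesis unfolding at[symmetric] by (rule diff_chain_within)
  qed
  have "f1 \<circ> (\<lambda>h. h *\<^sub>R u) = f2 \<circ> (\<lambda>h. h *\<^sub>R u)"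
    using chain[OF f1] chain[OF f2] by (rule has_derivative_unique)
  from fun_cong[OF this, of 1] show ?thesis by simp
qed

lemma parseval:
  fixes B :: "'a::euclidean_space set"
  assumes orth: "pairwise orthogonal B" and norm: "\<And>b. b \<in> B \<Longrightarrow> norm b = 1" and w: "w \<in> span B"
  shows "(\<Sum>b\<in>B. (w \<bullet> b)\<^sup>2) = (norm w)\<^sup>2"
proof -
  have fin: "finite B"
    using norm by (intro independent_imp_finite pairwise_orthogonal_independent orth) (metis norm_zero zero_neq_one)
  define w' where "w' = (\<Sum>b\<in>B. (w \<bullet> b) *\<^sub>R b)"
  have "orthogonal b (w - w')" if b: "b \<in> B" for b
  proof -
    have "w' \<bullet> b = (\<Sum>c\<in>B. if c = b then w \<bullet> b else 0)"
      unfolding w'_def inner_sum_left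
      using orth norm b by (intro sum.cong) (auto simp: pairwise_def orthogonal_def dot_square_norm)
    also have "\<dots> = w \<bullet> b" using fin b by simp
    finally show ?thesis by (simp add: orthogonal_def inner_diff_right inner_commute)
  qed
  moreover have "w - w' \<in> span B"
    unfolding w'_def by (intro span_diff w span_sum span_scale span_base)
  ultimately have "orthogonal (w - w') (w - w')"
    by (meson orthogonal_commute orthogonal_to_span)
  then have "w = w'" by (simp add: orthogonal_def)
  then have "(norm w)\<^sup>2 = w \<bullet> w'" by (simp add: power2_norm_eq_inner)
  also have "\<dots> = (\<Sum>b\<in>B. (w \<bullet> b)\<^sup>2)"
    by (simp add: w'_def inner_sum_right power2_eq_square)
  finally show ?thesis ..
qed

text \<open>
  The squared Hilbert-Schmidt norm of the compression of a self-adjoint map \<open>S\<close> to the hyperplane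
  orthogonal to \<open>\<nu>\<close>: adjoining \<open>\<nu>\<close> to \<open>B\<close> gives an orthonormal basis of the whole space, and the row
  and the column of \<open>\<nu>\<close> are subtracted.
\<close>

lemma sum_squares_restrict_hyperplane:
  fixes S :: "'a::euclidean_space \<Rightarrow> 'a"
  assumes B: "orthonormal_basis_of {u. \<nu> \<bullet> u = 0} B" and \<nu>: "norm \<nu> = 1"
    and S: "\<And>u v. S u \<bullet> v = u \<bullet> S v"
  shows "(\<Sum>u\<in>B. \<Sum>v\<in>B. (S u \<bullet> v)\<^sup>2)
    = (\<Sum>e\<in>Basis. (norm (S e))\<^sup>2) - 2 * (norm (S \<nu>))\<^sup>2 + (S \<nu> \<bullet> \<nu>)\<^sup>2"
proof -
  have orth: "pairwise orthogonal B" and norm: "\<And>b. b \<in> B \<Longrightarrow> norm b = 1"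
    and perp: "\<And>b. b \<in> B \<Longrightarrow> \<nu> \<bullet> b = 0" and span: "span B = {u. \<nu> \<bullet> u = 0}"
    using B by (auto simp: orthonormal_basis_of_def)
  have fin: "finite B"
    using norm by (intro independent_imp_finite pairwise_orthogonal_independent orth) (metis norm_zero zero_neq_one)
  have \<nu>\<nu>: "\<nu> \<bullet> \<nu> = 1" using \<nu> by (simp add: dot_square_norm)
  have notin: "\<nu> \<notin> B" using perp \<nu>\<nu> by force
  let ?B = "insert \<nu> B"
  have orth': "pairwise orthogonal ?B"
    using orth perp by (auto simp: pairwise_insert orthogonal_def inner_commute)
  have norm': "\<And>b. b \<in> ?B \<Longrightarrow> norm b = 1" using norm \<nu> by auto
  have span': "w \<in> span ?B" for w
  proof -
    have "w - (\<nu> \<bullet> w) *\<^sub>R \<nu> \<in> span B"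
      by (simp add: span inner_diff_right \<nu>\<nu>)
    then show ?thesis by (auto simp: span_insert)
  qed
  have pars: "(\<Sum>b\<in>?B. (w \<bullet> b)\<^sup>2) = (norm w)\<^sup>2" for w
    by (rule parseval[OF orth' norm' span'])
  have rest: "(\<Sum>v\<in>B. (w \<bullet> v)\<^sup>2) = (norm w)\<^sup>2 - (w \<bullet> \<nu>)\<^sup>2" for w
    using pars[of w] fin notin by simp
  have nsq: "(\<Sum>e\<in>Basis. (w \<bullet> e)\<^sup>2) = (norm w)\<^sup>2" for w :: 'a
    by (rule parseval) (auto simp: pairwise_def orthogonal_def inner_Basis)
  have "(\<Sum>u\<in>?B. (norm (S u))\<^sup>2) = (\<Sum>u\<in>?B. \<Sum>e\<in>Basis. (S u \<bullet> e)\<^sup>2)"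
    by (simp only: nsq)
  also have "\<dots> = (\<Sum>e\<in>Basis. \<Sum>u\<in>?B. (S e \<bullet> u)\<^sup>2)"
  proof -
    have sym: "S u \<bullet> v = S v \<bullet> u" for u v
      using S[of u v] by (simp only: inner_commute[of u])
    show ?thesis by (subst sum.swap) (intro sum.cong refl arg_cong[where f = "\<lambda>z. z\<^sup>2"] sym)
  qed
  also have "\<dots> = (\<Sum>e\<in>Basis. (norm (S e))\<^sup>2)" by (simp only: pars)
  finally have total: "(\<Sum>u\<in>B. (norm (S u))\<^sup>2) = (\<Sum>e\<in>Basis. (norm (S e))\<^sup>2) - (norm (S \<nu>))\<^sup>2"
    using fin notin by simp
  have sym: "S u \<bullet> \<nu> = S \<nu> \<bullet> u" for u
    using S[of u \<nu>] by (simp only: inner_commute[of u])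
  have "(\<Sum>u\<in>B. \<Sum>v\<in>B. (S u \<bullet> v)\<^sup>2) = (\<Sum>u\<in>B. (norm (S u))\<^sup>2) - (\<Sum>u\<in>B. (S \<nu> \<bullet> u)\<^sup>2)"
    unfolding sum_subtractf[symmetric] by (intro sum.cong refl) (simp only: rest sym)
  then show ?thesis by (simp add: total rest)
qed

section \<open>Geometry of the quadratic cone\<close>

text \<open>
  The cone \<open>|y| = \<gamma> |x|\<close>. A Lawson cone is the case \<open>\<gamma>\<^sup>2 = (h - 1) / (k - 1)\<close>.
\<close>

definition quad_cone :: "real \<Rightarrow> ('a::euclidean_space \<times> 'b::euclidean_space) set" where
  "quad_cone \<gamma> = {(x, y). norm y = \<gamma> * norm x}"

text \<open>
  The self-adjoint linear map \<open>S(x, y) = (\<gamma> x, - y / \<gamma>)\<close>. Up to a factor, \<open>S p\<close> is the gradient at \<open>p\<close>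
  of the quadratic form \<open>S p \<bullet> p\<close>, whose zero set is the cone. The scaling is chosen such that
  \<open>|S p| = |p|\<close> on the cone.
\<close>

definition normal_map :: "real \<Rightarrow> 'a::real_vector \<times> 'b::real_vector \<Rightarrow> 'a \<times> 'b" where
  "normal_map \<gamma> p = (\<gamma> *\<^sub>R fst p, - ((1 / \<gamma>) *\<^sub>R snd p))"

lemma normal_map_self_adjoint:
  fixes p q :: "'a::real_inner \<times> 'b::real_inner"
  shows "normal_map \<gamma> p \<bullet> q = p \<bullet> normal_map \<gamma> q"
  by (simp add: normal_map_def inner_prod_def)

lemma bounded_linear_normal_map:
  "bounded_linear (normal_map \<gamma> :: 'a::real_normed_vector \<times> 'b::real_normed_vector \<Rightarrow> _)"
  unfolding normal_map_def[abs_def]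
  by (intro bounded_linear_Pair bounded_linear_minus bounded_linear_const_scaleR bounded_linear_fst bounded_linear_snd)

lemma norm_normal_map: "0 < \<gamma> \<Longrightarrow> p \<in> quad_cone \<gamma> \<Longrightarrow> norm (normal_map \<gamma> p) = norm p"
  by (cases p) (simp add: quad_cone_def normal_map_def norm_Pair add.commute)

lemma quad_cone_iff:
  assumes "0 < \<gamma>"
  shows "p \<in> quad_cone \<gamma> \<longleftrightarrow> normal_map \<gamma> p \<bullet> p = 0"
proof (cases p)
  case (Pair x y)
  have "normal_map \<gamma> p \<bullet> p = \<gamma> * (norm x)\<^sup>2 - (norm y)\<^sup>2 / \<gamma>"
    by (simp add: Pair normal_map_def power2_norm_eq_inner)
  also have "\<dots> = 0 \<longleftrightarrow> (norm y)\<^sup>2 = (\<gamma> * norm x)\<^sup>2"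
    using assms by (auto simp: field_simps power2_eq_square)
  also have "\<dots> \<longleftrightarrow> norm y = \<gamma> * norm x"
    using assms by (intro power2_eq_iff_nonneg) auto
  finally show ?thesis by (simp add: Pair quad_cone_def)
qed

lemma quad_cone_coords:
  assumes "0 < \<gamma>" "(x, y) \<in> quad_cone \<gamma>" "(x, y) \<noteq> 0"
  shows "x \<noteq> 0" "y \<noteq> 0"
  using assms by (auto simp: quad_cone_def zero_prod_def)

text \<open>
  For the inclusion from right to left, the straight line \<open>t \<mapsto> p + t u\<close> is pushed back to the cone by
  rescaling its second component with a factor \<open>\<rho> t\<close>; orthogonality of \<open>u\<close> and \<open>S p\<close> gives
  \<open>\<rho>' 0 = 0\<close>, so that the velocity at \<open>0\<close> is still \<open>u\<close>.
\<close>

lemma tangent_space_quad_cone: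
  fixes p :: "'a::euclidean_space \<times> 'b::euclidean_space"
  assumes \<gamma>: "0 < \<gamma>" and p: "p \<in> quad_cone \<gamma>" "p \<noteq> 0"
  shows "tangent_space (quad_cone \<gamma>) p = {u. normal_map \<gamma> p \<bullet> u = 0}"
proof (intro set_eqI iffI; clarsimp)
  fix u1 u2 assume "(u1, u2) \<in> tangent_space (quad_cone \<gamma>) p"
  then obtain c \<epsilon> where c: "0 < \<epsilon>" "\<forall>t\<in>{-\<epsilon><..<\<epsilon>}. c t \<in> quad_cone \<gamma>" "c 0 = p"
      "(c has_vector_derivative (u1, u2)) (at 0)"
    unfolding tangent_space_def by blast
  have c': "(c has_derivative (\<lambda>h. h *\<^sub>R (u1, u2))) (at 0)"
    using c(4) by (simp add: has_vector_derivative_def)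
  have "((\<lambda>t. normal_map \<gamma> (c t) \<bullet> c t) has_derivative
      (\<lambda>h. normal_map \<gamma> (c 0) \<bullet> (h *\<^sub>R (u1, u2)) + normal_map \<gamma> (h *\<^sub>R (u1, u2)) \<bullet> c 0)) (at 0)"
    by (intro has_derivative_inner bounded_linear.has_derivative[OF bounded_linear_normal_map] c')
  moreover have "((\<lambda>t. normal_map \<gamma> (c t) \<bullet> c t) has_derivative (\<lambda>h. 0)) (at 0)"
    by (rule has_derivative_transform_within_open[where f = "\<lambda>_. 0" and s = "{-\<epsilon><..<\<epsilon>}"])
       (use c in \<open>auto simp: quad_cone_iff[OF \<gamma>, symmetric]\<close>)
  ultimately have "(\<lambda>h. normal_map \<gamma> (c 0) \<bullet> (h *\<^sub>R (u1, u2)) + normal_map \<gamma> (h *\<^sub>R (u1, u2)) \<bullet> c 0) = (\<lambda>h. 0)"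
    by (rule has_derivative_unique)
  from fun_cong[OF this, of 1] have "normal_map \<gamma> p \<bullet> (u1, u2) + normal_map \<gamma> (u1, u2) \<bullet> p = 0"
    using c(3) by simp
  moreover have "normal_map \<gamma> (u1, u2) \<bullet> p = normal_map \<gamma> p \<bullet> (u1, u2)"
    by (subst normal_map_self_adjoint) (rule inner_commute)
  ultimately show "normal_map \<gamma> p \<bullet> (u1, u2) = 0" by linarith
next
  fix u1 :: 'a and u2 :: 'b assume u: "normal_map \<gamma> p \<bullet> (u1, u2) = 0"
  obtain x y where xy: "p = (x, y)" by (cases p)
  have nz: "x \<noteq> 0" "y \<noteq> 0" using quad_cone_coords[OF \<gamma>] p xy by auto
  have ny: "norm y = \<gamma> * norm x" using p by (simp add: xy quad_cone_def)
  define a b where "a t = x + t *\<^sub>R u1" and "b t = y + t *\<^sub>R u2" for t :: real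
  define \<rho> where "\<rho> t = \<gamma> * norm (a t) / norm (b t)" for t
  define c where "c t = (a t, \<rho> t *\<^sub>R b t)" for t
  define \<rho>' where "\<rho>' t = \<gamma> * ((u1 \<bullet> a t) / (norm (a t) * norm (b t)) - norm (a t) * (u2 \<bullet> b t) / (norm (b t))^3)" for t
  have ab: "continuous_on UNIV a" "continuous_on UNIV b"
    unfolding a_def b_def by (intro continuous_intros)+
  obtain \<epsilon> where \<epsilon>: "0 < \<epsilon>" "\<And>t. \<bar>t\<bar> < \<epsilon> \<Longrightarrow> a t \<noteq> 0 \<and> b t \<noteq> 0"
  proof -
    have "open {t. a t \<noteq> 0 \<and> b t \<noteq> 0}"
      unfolding Collect_conj_eq using ab by (intro open_Int open_Collect_neq continuous_on_const) auto
    moreover have "0 \<in> {t. a t \<noteq> 0 \<and> b t \<noteq> 0}" using nz by (simp add: a_def b_def)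
    ultimately obtain e where "e > 0" "ball 0 e \<subseteq> {t. a t \<noteq> 0 \<and> b t \<noteq> 0}"
      unfolding open_contains_ball by blast
    then show ?thesis using that[of e] by (auto simp: subset_eq)
  qed
  have norm_deriv: "((\<lambda>t. norm (z + t *\<^sub>R v)) has_real_derivative (v \<bullet> (z + t *\<^sub>R v)) / norm (z + t *\<^sub>R v)) (at t)"
    if "z + t *\<^sub>R v \<noteq> 0" for z v :: "'c::euclidean_space" and t
  proof -
    have "((\<lambda>t. norm (z + t *\<^sub>R v)) has_derivative (\<lambda>h. h *\<^sub>R v \<bullet> sgn (z + t *\<^sub>R v))) (at t)"
      by (rule has_derivative_compose[of "\<lambda>t. z + t *\<^sub>R v", OF _ has_derivative_norm[OF that]])
        (auto intro!: derivative_eq_intros)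
    moreover have "(\<lambda>h. h *\<^sub>R v \<bullet> sgn (z + t *\<^sub>R v)) = (*) ((v \<bullet> (z + t *\<^sub>R v)) / norm (z + t *\<^sub>R v))"
      by (simp add: fun_eq_iff sgn_div_norm divide_inverse)
    ultimately show ?thesis by (simp add: has_field_derivative_def)
  qed
  have \<rho>_deriv: "(\<rho> has_real_derivative \<rho>' t) (at t)" if "\<bar>t\<bar> < \<epsilon>" for t
  proof -
    have nab: "a t \<noteq> 0" "b t \<noteq> 0" using \<epsilon> that by auto
    have "((\<lambda>t. \<gamma> * norm (a t) / norm (b t)) has_real_derivative
       ((\<gamma> * ((u1 \<bullet> a t) / norm (a t))) * norm (b t) - (\<gamma> * norm (a t)) * ((u2 \<bullet> b t) / norm (b t)))
          / (norm (b t) * norm (b t))) (at t)"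
      unfolding a_def b_def
      by (intro DERIV_divide DERIV_cmult norm_deriv) (use nab in \<open>auto simp: a_def b_def\<close>)
    also have "((\<gamma> * ((u1 \<bullet> a t) / norm (a t))) * norm (b t) - (\<gamma> * norm (a t)) * ((u2 \<bullet> b t) / norm (b t)))
          / (norm (b t) * norm (b t)) = \<rho>' t"
      using nab by (simp add: \<rho>'_def field_simps power3_eq_cube)
    finally show ?thesis by (simp add: \<rho>_def[abs_def])
  qed
  have c_deriv: "(c has_vector_derivative (u1, \<rho> t *\<^sub>R u2 + \<rho>' t *\<^sub>R b t)) (at t)" if "\<bar>t\<bar> < \<epsilon>" for t
    unfolding c_def
  proof (intro has_vector_derivative_Pair has_vector_derivative_scaleR \<rho>_deriv that)
    show "(a has_vector_derivative u1) (at t)" "(b has_vector_derivative u2) (at t)"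
      unfolding a_def[abs_def] b_def[abs_def] by (auto intro!: derivative_eq_intros)
  qed
  have cont: "continuous_on {-\<epsilon><..<\<epsilon>} (\<lambda>t. (u1, \<rho> t *\<^sub>R u2 + \<rho>' t *\<^sub>R b t))"
    unfolding \<rho>_def \<rho>'_def using \<epsilon>(2)
    by (intro continuous_intros continuous_on_subset[OF ab(1)] continuous_on_subset[OF ab(2)])
       (auto simp: abs_less_iff)
  have "\<rho> 0 = 1" using ny nz \<gamma> by (simp add: \<rho>_def a_def b_def)
  moreover have "\<rho>' 0 = 0"
  proof -
    have "\<gamma> * (x \<bullet> u1) = (y \<bullet> u2) / \<gamma>" using u by (simp add: xy normal_map_def)
    then have "y \<bullet> u2 = \<gamma>\<^sup>2 * (x \<bullet> u1)" using \<gamma> by (simp add: field_simps power2_eq_square)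
    then show ?thesis using nz \<gamma>
      by (simp add: \<rho>'_def a_def b_def ny inner_commute field_simps power2_eq_square power3_eq_cube)
  qed
  ultimately have "(c has_vector_derivative (u1, u2)) (at 0)"
    using c_deriv[of 0] \<epsilon>(1) by simp
  moreover have "c C1_differentiable_on {-\<epsilon><..<\<epsilon>}"
    unfolding C1_differentiable_on_def
    using c_deriv cont by (intro exI[of _ "\<lambda>t. (u1, \<rho> t *\<^sub>R u2 + \<rho>' t *\<^sub>R b t)"]) auto
  moreover have "c t \<in> quad_cone \<gamma>" if "t \<in> {-\<epsilon><..<\<epsilon>}" for t
    using \<epsilon>(2)[of t] that \<gamma> by (auto simp: quad_cone_def c_def \<rho>_def abs_less_iff)
  moreover have "c 0 = p" using \<open>\<rho> 0 = 1\<close> by (simp add: c_def a_def b_def xy)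
  ultimately show "(u1, u2) \<in> tangent_space (quad_cone \<gamma>) p"
    unfolding tangent_space_def using \<epsilon>(1) by blast
qed

text \<open>
  The global unit normal field \<open>S p / |p|\<close> of the cone without the origin.
\<close>

definition cone_normal :: "real \<Rightarrow> 'a::euclidean_space \<times> 'b::euclidean_space \<Rightarrow> 'a \<times> 'b" where
  "cone_normal \<gamma> p = inverse (norm p) *\<^sub>R normal_map \<gamma> p"

lemma norm_cone_normal:
  assumes "0 < \<gamma>" "p \<in> quad_cone \<gamma>" "p \<noteq> 0"
  shows "norm (cone_normal \<gamma> p) = 1"
  using assms by (simp add: cone_normal_def norm_normal_map)

lemma cone_normal_orthogonal_iff:
  assumes "p \<noteq> 0"
  shows "cone_normal \<gamma> p \<bullet> u = 0 \<longleftrightarrow> normal_map \<gamma> p \<bullet> u = 0"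
  using assms by (simp add: cone_normal_def)

lemma tangent_space_cone_normal:
  assumes "0 < \<gamma>" "p \<in> quad_cone \<gamma>" "p \<noteq> 0"
  shows "tangent_space (quad_cone \<gamma>) p = {u. cone_normal \<gamma> p \<bullet> u = 0}"
  using assms by (simp add: tangent_space_quad_cone cone_normal_orthogonal_iff)

text \<open>
  The derivative of the factor \<open>1 / |p|\<close> contributes a multiple of \<open>S p\<close>, which is normal and therefore
  irrelevant for the second fundamental form; it is left unspecified.
\<close>

lemma cone_normal_has_derivative:
  assumes "p \<noteq> 0"
  shows "\<exists>f. (cone_normal \<gamma> has_derivative (\<lambda>u. inverse (norm p) *\<^sub>R normal_map \<gamma> u + f u *\<^sub>R normal_map \<gamma> p)) (at p)"
proof -
  have "norm p \<noteq> 0" using assms by simp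
  then obtain f where "((\<lambda>p. inverse (norm p)) has_derivative f) (at p)"
    using Deriv.has_derivative_inverse[OF _ has_derivative_norm[OF assms]] by blast
  then show ?thesis
    unfolding cone_normal_def[abs_def]
    by (intro exI has_derivative_scaleR bounded_linear.has_derivative[OF bounded_linear_normal_map] has_derivative_ident)
qed

lemma local_unit_normal_cone_normal:
  assumes "0 < \<gamma>" "p \<noteq> 0"
  shows "local_unit_normal (quad_cone \<gamma>) p (cone_normal \<gamma>)"
  unfolding local_unit_normal_def
proof (intro exI[of _ "- {0}"] conjI ballI)
  fix q :: "'a \<times> 'b" assume q: "q \<in> quad_cone \<gamma> \<inter> - {0}"
  then show "norm (cone_normal \<gamma> q) = 1" using assms by (simp add: norm_cone_normal)
  show "cone_normal \<gamma> q \<bullet> v = 0" if "v \<in> tangent_space (quad_cone \<gamma>) q" for v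
    using that q assms by (simp add: tangent_space_cone_normal)
  show "cone_normal \<gamma> differentiable (at q within quad_cone \<gamma>)"
    using q cone_normal_has_derivative[of q \<gamma>] has_derivative_at_withinI
    by (fastforce simp: differentiable_def)
qed (use assms in auto)

lemma orthogonal_to_tangent_space:
  assumes \<gamma>: "0 < \<gamma>" and q: "q \<in> quad_cone \<gamma>" "q \<noteq> 0"
    and w: "\<And>v. v \<in> tangent_space (quad_cone \<gamma>) q \<Longrightarrow> w \<bullet> v = 0"
  shows "w = (w \<bullet> cone_normal \<gamma> q) *\<^sub>R cone_normal \<gamma> q"
proof -
  let ?\<nu> = "cone_normal \<gamma> q"
  have \<nu>: "?\<nu> \<bullet> ?\<nu> = 1" using norm_cone_normal[OF \<gamma> q] by (simp add: dot_square_norm)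
  define v where "v = w - (w \<bullet> ?\<nu>) *\<^sub>R ?\<nu>"
  have 1: "?\<nu> \<bullet> v = 0" by (simp add: v_def inner_diff_right \<nu> inner_commute)
  then have "w \<bullet> v = 0" by (intro w) (simp add: tangent_space_cone_normal[OF \<gamma> q])
  then have "v \<bullet> v = 0" using 1 by (simp add: v_def inner_diff_left)
  then show ?thesis by (simp add: v_def)
qed

text \<open>
  The unit normal in the definition of the second fundamental form is arbitrary. As it is continuous,
  it agrees on the cone near \<open>p\<close> with \<open>cone_normal\<close> up to a constant sign.
\<close>

lemma local_unit_normal_unique:
  assumes \<gamma>: "0 < \<gamma>" and p: "p \<in> quad_cone \<gamma>" "p \<noteq> 0"
    and \<nu>: "local_unit_normal (quad_cone \<gamma>) p \<nu>"
  obtains \<sigma> V where "\<bar>\<sigma>\<bar> = 1" "open V" "p \<in> V"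
    "\<And>q. q \<in> quad_cone \<gamma> \<inter> V \<Longrightarrow> \<nu> q = \<sigma> *\<^sub>R cone_normal \<gamma> q"
proof -
  obtain U where U: "open U" "p \<in> U"
    and U_unit: "\<And>q. q \<in> quad_cone \<gamma> \<inter> U \<Longrightarrow> norm (\<nu> q) = 1"
    and U_perp: "\<And>q v. q \<in> quad_cone \<gamma> \<inter> U \<Longrightarrow> v \<in> tangent_space (quad_cone \<gamma>) q \<Longrightarrow> \<nu> q \<bullet> v = 0"
    and U_diff: "\<And>q. q \<in> quad_cone \<gamma> \<inter> U \<Longrightarrow> \<nu> differentiable (at q within quad_cone \<gamma>)"
    using \<nu> unfolding local_unit_normal_def by blast
  define a where "a q = \<nu> q \<bullet> cone_normal \<gamma> q" for q
  have a: "\<nu> q = a q *\<^sub>R cone_normal \<gamma> q" "\<bar>a q\<bar> = 1" if "q \<in> quad_cone \<gamma> \<inter> U" "q \<noteq> 0" for q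
  proof -
    show 1: "\<nu> q = a q *\<^sub>R cone_normal \<gamma> q"
      unfolding a_def using that U_perp by (intro orthogonal_to_tangent_space \<gamma>) auto
    have "norm (\<nu> q) = \<bar>a q\<bar>" using that \<gamma> by (subst 1) (simp add: norm_cone_normal)
    then show "\<bar>a q\<bar> = 1" using U_unit that by simp
  qed
  have "(\<nu> \<longlongrightarrow> \<nu> p) (at p within quad_cone \<gamma>)"
    using differentiable_imp_continuous_within[OF U_diff[of p]] p U by (simp add: continuous_within)
  moreover have "(cone_normal \<gamma> \<longlongrightarrow> cone_normal \<gamma> p) (at p within quad_cone \<gamma>)"
    using cone_normal_has_derivative[OF p(2), of \<gamma>]
    unfolding continuous_within[symmetric] by (blast intro: has_derivative_continuous has_derivative_at_withinI)
  ultimately have "(a \<longlongrightarrow> a p) (at p within quad_cone \<gamma>)"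
    unfolding a_def[abs_def] by (intro tendsto_inner)
  then have "\<forall>\<^sub>F q in at p within quad_cone \<gamma>. dist (a q) (a p) < 1"
    by (rule tendstoD) simp
  then obtain d where d: "0 < d" "\<And>q. q \<in> quad_cone \<gamma> \<Longrightarrow> dist q p < d \<Longrightarrow> dist (a q) (a p) < 1"
    unfolding eventually_at by (metis dist_self zero_less_one)
  show ?thesis
  proof
    show "\<bar>a p\<bar> = 1" using a p U by auto
    show "open (U \<inter> ball p d \<inter> - {0})" "p \<in> U \<inter> ball p d \<inter> - {0}" using U d p by auto
    fix q assume q: "q \<in> quad_cone \<gamma> \<inter> (U \<inter> ball p d \<inter> - {0})"
    then have "dist (a q) (a p) < 1" using d(2)[of q] by (auto simp: dist_commute)
    moreover have "\<bar>a q\<bar> = 1" "\<bar>a p\<bar> = 1" using a(2)[of q] a(2)[of p] q p U by auto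
    ultimately have "a q = a p" by (auto simp: dist_real_def abs_if split: if_splits)
    then show "\<nu> q = a p *\<^sub>R cone_normal \<gamma> q" using a(1)[of q] q by auto
  qed
qed

lemma second_fundamental_form_quad_cone:
  assumes \<gamma>: "0 < \<gamma>" and p: "p \<in> quad_cone \<gamma>" "p \<noteq> 0"
    and u: "u \<in> tangent_space (quad_cone \<gamma>) p" and v: "v \<in> tangent_space (quad_cone \<gamma>) p"
  shows "second_fundamental_form (quad_cone \<gamma>) p u v
    = - ((normal_map \<gamma> u \<bullet> v) / norm p) *\<^sub>R cone_normal \<gamma> p"
proof -
  define \<nu> where "\<nu> = (SOME \<nu>. local_unit_normal (quad_cone \<gamma>) p \<nu>)"
  have \<nu>: "local_unit_normal (quad_cone \<gamma>) p \<nu>"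
    unfolding \<nu>_def by (rule someI[of "local_unit_normal (quad_cone \<gamma>) p", OF local_unit_normal_cone_normal[OF \<gamma> p(2)]])
  obtain \<sigma> V where \<sigma>: "\<bar>\<sigma>\<bar> = 1" and V: "open V" "p \<in> V"
    and eq: "\<And>q. q \<in> quad_cone \<gamma> \<inter> V \<Longrightarrow> \<nu> q = \<sigma> *\<^sub>R cone_normal \<gamma> q"
    using local_unit_normal_unique[OF \<gamma> p \<nu>] by blast
  let ?A = "at p within quad_cone \<gamma>"
  obtain f where f: "(cone_normal \<gamma> has_derivative
      (\<lambda>u. inverse (norm p) *\<^sub>R normal_map \<gamma> u + f u *\<^sub>R normal_map \<gamma> p)) ?A"
    using cone_normal_has_derivative[OF p(2)] has_derivative_at_withinI by blast
  obtain d where d: "0 < d" "ball p d \<subseteq> V" using V open_contains_ball by blast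
  have *: "(\<nu> has_derivative
      (\<lambda>u. \<sigma> *\<^sub>R (inverse (norm p) *\<^sub>R normal_map \<gamma> u + f u *\<^sub>R normal_map \<gamma> p))) ?A"
    by (rule has_derivative_transform_within[OF has_derivative_scaleR_right[OF f] d(1) p(1)])
       (use d eq in \<open>auto simp: dist_commute subset_eq\<close>)
  then have "(\<nu> has_derivative frechet_derivative \<nu> ?A) ?A"
    unfolding frechet_derivative_works[symmetric] by (auto simp: differentiable_def)
  from has_derivative_within_tangent_unique[OF this * u]
  have "frechet_derivative \<nu> ?A u \<bullet> v
      = \<sigma> * ((normal_map \<gamma> u \<bullet> v) / norm p + f u * (normal_map \<gamma> p \<bullet> v))"
    by (simp add: inner_add_left divide_inverse mult.commute)
  also have "normal_map \<gamma> p \<bullet> v = 0" using v by (simp add: tangent_space_quad_cone[OF \<gamma> p])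
  finally have "second_fundamental_form (quad_cone \<gamma>) p u v
      = - ((\<sigma> * \<sigma>) * ((normal_map \<gamma> u \<bullet> v) / norm p)) *\<^sub>R cone_normal \<gamma> p"
    unfolding second_fundamental_form_def Let_def \<nu>_def[symmetric] using eq[of p] p V
    by (simp add: mult_ac)
  also have "\<sigma> * \<sigma> = 1" using \<sigma> by (metis abs_mult_self_eq mult_1)
  finally show ?thesis by simp
qed

text \<open>
  The hypothesis \<open>minimal\<close> on \<open>\<gamma>\<close> is the condition for the mean curvature to vanish.
\<close>

lemma second_fundamental_form_norm_sq_quad_cone:
  fixes p :: "'a::euclidean_space \<times> 'b::euclidean_space"
  assumes \<gamma>: "0 < \<gamma>" and p: "p \<in> quad_cone \<gamma>" "p \<noteq> 0"
    and minimal: "\<gamma>\<^sup>2 * (real DIM('a) - 1) = real DIM('b) - 1"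
  shows "second_fundamental_form_norm_sq (quad_cone \<gamma>) p
    = (real DIM('a) + real DIM('b) - 2) / (norm p)\<^sup>2"
proof -
  let ?T = "tangent_space (quad_cone \<gamma>) p" and ?\<nu> = "cone_normal \<gamma> p"
  let ?S = "normal_map \<gamma> :: 'a \<times> 'b \<Rightarrow> 'a \<times> 'b"
  define B where "B = (SOME B. orthonormal_basis_of ?T B)"
  have T: "?T = {u. ?\<nu> \<bullet> u = 0}" by (rule tangent_space_cone_normal[OF \<gamma> p])
  have "subspace ?T" unfolding T by (rule subspace_hyperplane)
  then have "\<exists>B. orthonormal_basis_of ?T B"
    by (metis orthonormal_basis_subspace orthonormal_basis_of_def)
  then have B: "orthonormal_basis_of ?T B" unfolding B_def by (rule someI_ex)
  then have BT: "B \<subseteq> ?T" by (simp add: orthonormal_basis_of_def)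
  have "second_fundamental_form_norm_sq (quad_cone \<gamma>) p
      = (\<Sum>u\<in>B. \<Sum>v\<in>B. (?S u \<bullet> v)\<^sup>2 / (norm p)\<^sup>2)"
    unfolding second_fundamental_form_norm_sq_def Let_def B_def[symmetric]
    using BT by (intro sum.cong refl)
      (auto simp: second_fundamental_form_quad_cone[OF \<gamma> p] norm_cone_normal[OF \<gamma> p] power_divide subset_eq)
  also have "\<dots> = (\<Sum>u\<in>B. \<Sum>v\<in>B. (?S u \<bullet> v)\<^sup>2) / (norm p)\<^sup>2"
    by (simp add: sum_divide_distrib)
  also have "(\<Sum>u\<in>B. \<Sum>v\<in>B. (?S u \<bullet> v)\<^sup>2)
      = (\<Sum>e\<in>Basis. (norm (?S e))\<^sup>2) - 2 * (norm (?S ?\<nu>))\<^sup>2 + (?S ?\<nu> \<bullet> ?\<nu>)\<^sup>2"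
    using B unfolding T
    by (rule sum_squares_restrict_hyperplane[OF _ norm_cone_normal[OF \<gamma> p] normal_map_self_adjoint])
  also have "(\<Sum>e\<in>Basis. (norm (?S e))\<^sup>2) = \<gamma>\<^sup>2 * DIM('a) + DIM('b) / \<gamma>\<^sup>2"
  proof -
    have "inj_on (\<lambda>u. (u::'a, 0::'b)) Basis" "inj_on (\<lambda>u. (0::'a, u::'b)) Basis"
      by (auto intro!: inj_onI)
    then show ?thesis
      unfolding Basis_prod_def
      by (subst sum.union_disjoint)
         (auto simp: sum.reindex normal_map_def norm_Pair power_mult_distrib power_divide)
  qed
  also have "\<gamma>\<^sup>2 * DIM('a) + DIM('b) / \<gamma>\<^sup>2 - 2 * (norm (?S ?\<nu>))\<^sup>2 + (?S ?\<nu> \<bullet> ?\<nu>)\<^sup>2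
      = real DIM('a) + real DIM('b) - 2"
  proof -
    obtain x y where xy: "p = (x, y)" by (cases p)
    have nz: "x \<noteq> 0" using quad_cone_coords[OF \<gamma>] p xy by auto
    have ny: "norm y = \<gamma> * norm x" using p by (simp add: xy quad_cone_def)
    define g where "g = \<gamma>\<^sup>2"
    have g: "0 < g" using \<gamma> by (simp add: g_def)
    have np: "(norm p)\<^sup>2 = (1 + g) * (norm x)\<^sup>2"
      by (simp add: xy norm_Pair ny g_def power_mult_distrib algebra_simps)
    have S\<nu>: "?S ?\<nu> = inverse (norm p) *\<^sub>R (\<gamma>\<^sup>2 *\<^sub>R x, (1 / \<gamma>\<^sup>2) *\<^sub>R y)"
      by (simp add: cone_normal_def normal_map_def xy power2_eq_square)
    have "(norm (?S ?\<nu>))\<^sup>2 = (\<gamma>^4 * (norm x)\<^sup>2 + (norm y)\<^sup>2 / \<gamma>^4) / (norm p)\<^sup>2"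
      unfolding S\<nu> norm_scaleR power_mult_distrib norm_Pair
      by (simp add: power_mult_distrib power_divide power_inverse divide_inverse)
    also have "\<dots> = (g * g + 1 / g) * (norm x)\<^sup>2 / (norm p)\<^sup>2"
      using \<gamma> by (simp add: ny g_def power_mult_distrib field_simps power4_eq_xxxx power2_eq_square)
    also have "\<dots> = (g * g + 1 / g) / (1 + g)" using nz g by (simp add: np)
    also have "g * g + 1 / g = (g\<^sup>2 - g + 1) / g * (1 + g)" using g by (simp add: field_simps power2_eq_square)
    also have "\<dots> / (1 + g) = (g\<^sup>2 - g + 1) / g" using g by simp
    finally have 1: "(norm (?S ?\<nu>))\<^sup>2 = (g\<^sup>2 - g + 1) / g" .
    have "?S ?\<nu> \<bullet> ?\<nu> = (\<gamma>^3 * (norm x)\<^sup>2 - (norm y)\<^sup>2 / \<gamma>^3) / (norm p)\<^sup>2"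
      unfolding S\<nu> unfolding cone_normal_def normal_map_def xy
      by (simp add: power2_norm_eq_inner[symmetric] diff_divide_distrib)
         (simp add: field_simps power3_eq_cube power2_eq_square)
    also have "\<dots> = ((g - 1) * (g + 1) / \<gamma>) * (norm x)\<^sup>2 / (norm p)\<^sup>2"
      using \<gamma> by (simp add: ny g_def power_mult_distrib field_simps power3_eq_cube power2_eq_square)
    also have "\<dots> = (g - 1) / \<gamma> * ((1 + g) * (norm x)\<^sup>2) / (norm p)\<^sup>2" by (simp add: add.commute)
    also have "\<dots> = (g - 1) / \<gamma>" unfolding np using nz g by simp
    finally have 2: "(?S ?\<nu> \<bullet> ?\<nu>)\<^sup>2 = (g - 1)\<^sup>2 / g" by (simp add: power_divide g_def)
    have b: "real DIM('b) = g * (real DIM('a) - 1) + 1" using minimal by (simp add: g_def)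
    show ?thesis
      unfolding 1 2 g_def[symmetric] b using g by (simp add: field_simps power2_eq_square)
  qed
  finally show ?thesis .
qed

lemma tangential_gradient_quad_cone:
  assumes \<gamma>: "0 < \<gamma>" and p: "p \<in> quad_cone \<gamma>" "p \<noteq> 0"
    and \<Phi>: "GDERIV \<Phi> p :> d" and eq: "\<And>x. x \<in> quad_cone \<gamma> \<Longrightarrow> \<phi> x = \<Phi> x"
  shows "tangential_gradient (quad_cone \<gamma>) \<phi> p = d - (d \<bullet> cone_normal \<gamma> p) *\<^sub>R cone_normal \<gamma> p"
proof -
  let ?T = "tangent_space (quad_cone \<gamma>) p" and ?\<nu> = "cone_normal \<gamma> p"
  let ?A = "at p within quad_cone \<gamma>"
  have T: "?T = {u. ?\<nu> \<bullet> u = 0}" by (rule tangent_space_cone_normal[OF \<gamma> p])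
  have \<nu>: "?\<nu> \<bullet> ?\<nu> = 1" using norm_cone_normal[OF \<gamma> p] by (simp add: dot_square_norm)
  have "(\<Phi> has_derivative (\<lambda>h. h \<bullet> d)) ?A"
    using \<Phi> by (auto simp: gderiv_def intro: has_derivative_at_withinI)
  then have *: "(\<phi> has_derivative (\<lambda>h. h \<bullet> d)) ?A"
    by (rule has_derivative_transform_within[OF _ zero_less_one p(1)]) (simp add: eq)
  then have "(\<phi> has_derivative frechet_derivative \<phi> ?A) ?A"
    unfolding frechet_derivative_works[symmetric] by (auto simp: differentiable_def)
  then have fr: "frechet_derivative \<phi> ?A u = d \<bullet> u" if "u \<in> ?T" for u
    using has_derivative_within_tangent_unique[OF _ * that] by (simp add: inner_commute)
  let ?v = "d - (d \<bullet> ?\<nu>) *\<^sub>R ?\<nu>"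
  have v: "?v \<in> ?T" by (simp add: T inner_diff_right \<nu> inner_commute)
  have vu: "?v \<bullet> u = d \<bullet> u" if "u \<in> ?T" for u using that by (simp add: T inner_diff_left)
  show ?thesis
    unfolding tangential_gradient_def
  proof (rule the_equality)
    show "?v \<in> ?T \<and> (\<forall>u\<in>?T. frechet_derivative \<phi> ?A u = ?v \<bullet> u)" using v fr vu by simp
    fix w assume w: "w \<in> ?T \<and> (\<forall>u\<in>?T. frechet_derivative \<phi> ?A u = w \<bullet> u)"
    then have wv: "w - ?v \<in> ?T" using v by (simp add: T inner_diff_right)
    then have "w \<bullet> (w - ?v) = ?v \<bullet> (w - ?v)" using w fr vu by metis
    then have "(w - ?v) \<bullet> (w - ?v) = 0" by (simp add: inner_diff_left)
    then show "w = ?v" by simp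
  qed
qed

section \<open>Hausdorff measure on the quadratic cone\<close>

text \<open>
  On the part of the cone where \<open>y \<bullet> j\<close> has a fixed sign and size comparable to \<open>|y|\<close>, the coordinate
  \<open>y \<bullet> j\<close> is a Lipschitz function of the other ones: its square is \<open>\<gamma>\<^sup>2 |x|\<^sup>2 - |z y|\<^sup>2\<close>, where \<open>z y\<close> is
  the part of \<open>y\<close> orthogonal to \<open>j\<close>, and the difference of the squares is divided by the sum
  \<open>y \<bullet> j + y' \<bullet> j\<close>, whose modulus is at least \<open>(|y| + |y'|) / DIM('b)\<close>.
\<close>

lemma quad_cone_piece_lipschitz:
  fixes x x' :: "'a::euclidean_space" and y y' :: "'b::euclidean_space" and \<gamma> d :: real
  assumes \<gamma>: "0 < \<gamma>" and M: "norm y = \<gamma> * norm x" "norm y' = \<gamma> * norm x'"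
    and \<sigma>: "\<bar>\<sigma>\<bar> = 1" and j: "j \<in> Basis"
    and large: "norm y / DIM('b) \<le> \<sigma> * (y \<bullet> j)" "norm y' / DIM('b) \<le> \<sigma> * (y' \<bullet> j)"
    and dx: "\<And>i. i \<in> Basis \<Longrightarrow> \<bar>(x - x') \<bullet> i\<bar> \<le> d"
    and dy: "\<And>i. i \<in> Basis - {j} \<Longrightarrow> \<bar>(y - y') \<bullet> i\<bar> \<le> d" and d: "0 < d"
  shows "norm ((x, y) - (x', y'))
    \<le> (DIM('a) + DIM('b) + DIM('b) * (\<gamma> * DIM('a) + DIM('b))) * d"
proof -
  define k h where "k = real DIM('a)" and "h = real DIM('b)"
  have h: "0 < h" "0 \<le> k" by (simp_all add: h_def k_def)
  define z where "z y = y - (y \<bullet> j) *\<^sub>R j" for y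
  have jj: "j \<bullet> j = 1" using j by simp
  have zz: "(norm y)\<^sup>2 = (norm (z y))\<^sup>2 + (y \<bullet> j)\<^sup>2" for y
    unfolding power2_norm_eq_inner z_def
    by (simp add: inner_diff_left inner_diff_right jj power2_eq_square inner_commute)
  have z_le: "norm (z y) \<le> norm y" for y
    by (rule power2_le_imp_le) (simp_all add: zz[of y])
  have nx: "norm (x - x') \<le> k * d"
  proof -
    have "norm (x - x') \<le> (\<Sum>i\<in>Basis. \<bar>(x - x') \<bullet> i\<bar>)" by (rule norm_le_l1)
    also have "\<dots> \<le> k * d" unfolding k_def by (rule sum_bounded_above[OF dx])
    finally show ?thesis .
  qed
  have nz: "norm (z y - z y') \<le> h * d"
  proof -
    have "norm (z y - z y') \<le> (\<Sum>i\<in>Basis. \<bar>(z y - z y') \<bullet> i\<bar>)" by (rule norm_le_l1)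
    also have "\<dots> \<le> h * d" unfolding h_def
    proof (rule sum_bounded_above)
      fix i :: 'b assume i: "i \<in> Basis"
      show "\<bar>(z y - z y') \<bullet> i\<bar> \<le> d"
      proof (cases "i = j")
        case True then show ?thesis using d by (simp add: z_def inner_diff_left jj)
      next
        case False
        then have "(z y - z y') \<bullet> i = (y - y') \<bullet> i"
          using i j by (simp add: z_def inner_diff_left inner_Basis)
        then show ?thesis using dy[of i] i False by simp
      qed
    qed
    finally show ?thesis .
  qed
  define s where "s = norm y + norm y'"
  have s: "0 \<le> s" by (simp add: s_def)
  have diff_sq: "\<bar>(norm v)\<^sup>2 - (norm v')\<^sup>2\<bar> \<le> e * (norm v + norm v')"
    if "norm (v - v') \<le> e" for v v' :: "'c::euclidean_space" and e
  proof -
    have "(norm v)\<^sup>2 - (norm v')\<^sup>2 = (norm v - norm v') * (norm v + norm v')"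
      by (simp add: power2_eq_square algebra_simps)
    then have "\<bar>(norm v)\<^sup>2 - (norm v')\<^sup>2\<bar> = \<bar>norm v - norm v'\<bar> * (norm v + norm v')"
      by (simp add: abs_mult)
    also have "\<dots> \<le> e * (norm v + norm v')"
      using that norm_triangle_ineq3[of v v'] by (intro mult_right_mono) auto
    finally show ?thesis .
  qed
  let ?\<Delta> = "\<bar>(y - y') \<bullet> j\<bar>"
  have "?\<Delta> * (s / h) \<le> ?\<Delta> * \<bar>y \<bullet> j + y' \<bullet> j\<bar>"
  proof (rule mult_left_mono)
    have "s / h \<le> \<sigma> * (y \<bullet> j + y' \<bullet> j)"
      using large by (simp add: s_def h_def add_divide_distrib distrib_left)
    also have "\<dots> \<le> \<bar>\<sigma>\<bar> * \<bar>y \<bullet> j + y' \<bullet> j\<bar>" by (metis abs_ge_self abs_mult)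
    finally show "s / h \<le> \<bar>y \<bullet> j + y' \<bullet> j\<bar>" using \<sigma> by simp
  qed simp
  also have "\<dots> = \<bar>(y \<bullet> j)\<^sup>2 - (y' \<bullet> j)\<^sup>2\<bar>"
    by (simp add: abs_mult[symmetric] inner_diff_left power2_eq_square algebra_simps)
  also have "(y \<bullet> j)\<^sup>2 - (y' \<bullet> j)\<^sup>2
      = \<gamma>\<^sup>2 * ((norm x)\<^sup>2 - (norm x')\<^sup>2) - ((norm (z y))\<^sup>2 - (norm (z y'))\<^sup>2)"
    using zz[of y] zz[of y'] by (simp add: M power_mult_distrib algebra_simps)
  also have "\<bar>\<dots>\<bar> \<le> \<gamma>\<^sup>2 * \<bar>(norm x)\<^sup>2 - (norm x')\<^sup>2\<bar> + \<bar>(norm (z y))\<^sup>2 - (norm (z y'))\<^sup>2\<bar>"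
    by (rule order_trans[OF abs_triangle_ineq4]) (simp add: abs_mult)
  also have "\<dots> \<le> \<gamma>\<^sup>2 * (k * d * (norm x + norm x')) + h * d * (norm (z y) + norm (z y'))"
    by (intro add_mono mult_left_mono diff_sq nx nz) simp
  also have "\<dots> \<le> \<gamma> * k * d * s + h * d * s"
  proof (rule add_mono)
    show "\<gamma>\<^sup>2 * (k * d * (norm x + norm x')) \<le> \<gamma> * k * d * s"
      by (simp add: s_def M power2_eq_square algebra_simps)
    show "h * d * (norm (z y) + norm (z y')) \<le> h * d * s"
      unfolding s_def using h d z_le by (intro mult_left_mono add_mono) auto
  qed
  finally have key: "?\<Delta> * s \<le> h * (\<gamma> * k + h) * d * s"
    using h by (simp add: field_simps)
  have \<Delta>: "?\<Delta> \<le> h * (\<gamma> * k + h) * d"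
  proof (cases "s = 0")
    case True
    then have "y = 0" "y' = 0" using add_nonneg_eq_0_iff[of "norm y" "norm y'"] by (auto simp: s_def)
    then show ?thesis using h d \<gamma> by simp
  next
    case False
    then show ?thesis using key s by (simp add: mult_le_cancel_right)
  qed
  have "y - y' = (z y - z y') + ((y - y') \<bullet> j) *\<^sub>R j"
    by (simp add: z_def inner_diff_left scaleR_diff_left)
  then have "norm (y - y') \<le> norm (z y - z y') + norm (((y - y') \<bullet> j) *\<^sub>R j)"
    by (metis norm_triangle_ineq)
  also have "norm (((y - y') \<bullet> j) *\<^sub>R j) = ?\<Delta>" using j by simp
  finally have "norm (y - y') \<le> h * d + h * (\<gamma> * k + h) * d" using nz \<Delta> by linarith
  moreover have "norm ((x, y) - (x', y')) \<le> norm (x - x') + norm (y - y')"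
    by (simp add: norm_Pair_le)
  ultimately show ?thesis using nx by (simp add: k_def h_def algebra_simps)
qed

lemma hausdorff_outer_quad_cone_cball_finite:
  fixes r \<gamma> :: real
  assumes \<gamma>: "0 < \<gamma>"
  shows "hausdorff_outer (real DIM('a \<times> 'b) - 1)
    ((quad_cone \<gamma> :: ('a::euclidean_space \<times> 'b::euclidean_space) set) \<inter> cball 0 r) < top"
proof -
  define P where "P = (\<lambda>(j, \<sigma>). {p \<in> (quad_cone \<gamma> :: ('a \<times> 'b) set) \<inter> cball 0 r.
      norm (snd p) / DIM('b) \<le> \<sigma> * (snd p \<bullet> j)})"
  have fin: "hausdorff_outer (real DIM('a \<times> 'b) - 1) (P (j, \<sigma>)) < top"
    if j: "j \<in> Basis" and \<sigma>: "\<bar>\<sigma>\<bar> = 1" for j \<sigma>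
  proof (rule hausdorff_outer_lipschitz_graph_finite)
    show "bounded (P (j, \<sigma>))" by (rule bounded_subset[OF bounded_cball[of 0 r]]) (auto simp: P_def)
    show "(0, j) \<in> Basis" using j by (simp add: Basis_prod_def)
    let ?L = "DIM('a) + DIM('b) + DIM('b) * (\<gamma> * DIM('a) + DIM('b))"
    show "0 \<le> ?L" using \<gamma> by simp
    fix p q d assume pq: "p \<in> P (j, \<sigma>)" "q \<in> P (j, \<sigma>)" and d: "0 < d"
      and le: "\<And>i. i \<in> Basis - {(0, j)} \<Longrightarrow> \<bar>(p - q) \<bullet> i\<bar> \<le> d"
    obtain x y x' y' where xy: "p = (x, y)" "q = (x', y')" by (cases p, cases q)
    show "norm (p - q) \<le> ?L * d" unfolding xy
    proof (rule quad_cone_piece_lipschitz[OF \<gamma> _ _ \<sigma> j])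
      show "\<bar>(x - x') \<bullet> i\<bar> \<le> d" if "i \<in> Basis" for i
        using le[of "(i, 0)"] that nonzero_Basis[OF that] by (auto simp: Basis_prod_def xy)
      show "\<bar>(y - y') \<bullet> i\<bar> \<le> d" if "i \<in> Basis - {j}" for i
        using le[of "(0, i)"] that by (auto simp: Basis_prod_def xy)
    qed (use pq d in \<open>auto simp: P_def quad_cone_def xy\<close>)
  qed
  have "(quad_cone \<gamma> :: ('a \<times> 'b) set) \<inter> cball 0 r \<subseteq> (\<Union>i\<in>Basis \<times> {1, - 1}. P i)"
  proof
    fix p :: "'a \<times> 'b" assume p: "p \<in> quad_cone \<gamma> \<inter> cball 0 r"
    have "\<exists>j\<in>Basis. norm (snd p) / DIM('b) \<le> \<bar>snd p \<bullet> j\<bar>"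
    proof (rule ccontr)
      assume "\<not> ?thesis"
      then have "(\<Sum>j\<in>Basis. \<bar>snd p \<bullet> j\<bar>) < (\<Sum>j\<in>(Basis::'b set). norm (snd p) / DIM('b))"
        by (intro sum_strict_mono) (auto simp: not_le)
      then show False using norm_le_l1[of "snd p"] by simp
    qed
    then obtain j where j: "j \<in> Basis" "norm (snd p) / DIM('b) \<le> \<bar>snd p \<bullet> j\<bar>" by blast
    then have "p \<in> P (j, 1) \<or> p \<in> P (j, - 1)" using p by (auto simp: P_def abs_if split: if_splits)
    then show "p \<in> (\<Union>i\<in>Basis \<times> {1, - 1}. P i)" using j by auto
  qed
  then have "hausdorff_outer (real DIM('a \<times> 'b) - 1) ((quad_cone \<gamma> :: ('a \<times> 'b) set) \<inter> cball 0 r)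
      \<le> hausdorff_outer (real DIM('a \<times> 'b) - 1) (\<Union>i\<in>Basis \<times> {1, - 1}. P i)"
    by (rule hausdorff_outer_mono)
  also have "\<dots> < top"
    using fin by (intro hausdorff_outer_UN_finite_less_top) auto
  finally show ?thesis .
qed

lemma closed_quad_cone: "closed (quad_cone \<gamma>)"
proof -
  have "quad_cone \<gamma> = {p. norm (snd p) = \<gamma> * norm (fst p)}" by (auto simp: quad_cone_def)
  also have "closed \<dots>" by (intro closed_Collect_eq continuous_intros)
  finally show ?thesis .
qed

lemma quad_cone_scaleR: "0 \<le> t \<Longrightarrow> p \<in> quad_cone \<gamma> \<Longrightarrow> t *\<^sub>R p \<in> quad_cone \<gamma>"
  by (auto simp: quad_cone_def)

text \<open>
  Hausdorff measure of codimension one, restricted to the cone.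
\<close>

definition quad_cone_measure :: "real \<Rightarrow> ('a::euclidean_space \<times> 'b::euclidean_space) measure" where
  "quad_cone_measure \<gamma> = restrict_space (hausdorff_measure (real DIM('a \<times> 'b) - 1)) (quad_cone \<gamma>)"

lemma space_quad_cone_measure [simp]: "space (quad_cone_measure \<gamma>) = quad_cone \<gamma>"
  by (simp add: quad_cone_measure_def space_restrict_space)

lemma sets_quad_cone_measure: "A \<in> sets (quad_cone_measure \<gamma>) \<longleftrightarrow> A \<in> sets borel \<and> A \<subseteq> quad_cone \<gamma>"
  unfolding quad_cone_measure_def
  by (subst sets_restrict_space_iff) (auto simp: borel_closed closed_quad_cone)

lemma emeasure_quad_cone_measure:
  fixes A :: "('a::euclidean_space \<times> 'b::euclidean_space) set"
  assumes "A \<in> sets borel" "A \<subseteq> quad_cone \<gamma>"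
  shows "emeasure (quad_cone_measure \<gamma>) A = hausdorff_outer (real DIM('a \<times> 'b) - 1) A"
  unfolding quad_cone_measure_def using assms
  by (subst emeasure_restrict_space) (auto simp: emeasure_hausdorff_measure borel_closed closed_quad_cone)

lemma hypersurface_integral_quad_cone:
  "hypersurface_integral (quad_cone \<gamma>) f = (\<integral>x. f x \<partial>quad_cone_measure \<gamma>)"
  unfolding hypersurface_integral_def quad_cone_measure_def set_lebesgue_integral_def
  by (subst integral_restrict_space) (auto simp: borel_closed closed_quad_cone)

lemma cone_measure_quad_cone:
  assumes \<gamma>: "0 < \<gamma>"
  shows "cone_measure (quad_cone_measure \<gamma> :: ('a::euclidean_space \<times> 'b::euclidean_space) measure)
           (real DIM('a \<times> 'b) - 1)"
proof
  let ?\<mu> = "quad_cone_measure \<gamma> :: ('a \<times> 'b) measure"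
  show "sets ?\<mu> = sets (restrict_space borel (space ?\<mu>))"
    unfolding space_quad_cone_measure unfolding quad_cone_measure_def
    by (rule sets_restrict_space_cong) simp
  show "t *\<^sub>R x \<in> space ?\<mu>" if "x \<in> space ?\<mu>" "0 < t" for x t
    using that by (simp add: quad_cone_scaleR)
  show "emeasure ?\<mu> ((*\<^sub>R) t ` A) = ennreal (t powr (real DIM('a \<times> 'b) - 1)) * emeasure ?\<mu> A"
    if t: "0 < t" and A: "A \<in> sets ?\<mu>" for t A
  proof -
    have A': "A \<in> sets borel" "A \<subseteq> quad_cone \<gamma>" using A by (auto simp: sets_quad_cone_measure)
    have "(*\<^sub>R) t ` A = (*\<^sub>R) (inverse t) -` A \<inter> space borel"
    proof (intro set_eqI iffI)
      fix x assume "x \<in> (*\<^sub>R) (inverse t) -` A \<inter> space borel"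
      moreover have "x = t *\<^sub>R (inverse t *\<^sub>R x)" using t by simp
      ultimately show "x \<in> (*\<^sub>R) t ` A" by blast
    qed (use t in auto)
    also have "\<dots> \<in> sets borel" by (rule measurable_sets[OF _ A'(1)]) simp
    finally have "(*\<^sub>R) t ` A \<in> sets borel" .
    moreover have "(*\<^sub>R) t ` A \<subseteq> quad_cone \<gamma>" using A'(2) t by (auto intro!: quad_cone_scaleR simp del: scaleR_Pair)
    moreover have "0 \<le> real DIM('a) + real DIM('b) - 1"
    proof -
      have "1 \<le> DIM('a)" by (simp add: Suc_leI)
      then show ?thesis by linarith
    qed
    ultimately show ?thesis
      using A' t by (simp add: emeasure_quad_cone_measure hausdorff_outer_scaleR)
  qed
  show "emeasure ?\<mu> (space ?\<mu> \<inter> cball 0 r) < top" for r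
    using hausdorff_outer_quad_cone_cball_finite[OF \<gamma>, of r, where 'a='a and 'b='b]
    by (simp add: emeasure_quad_cone_measure borel_closed closed_quad_cone closed_Int)
qed

lemma AE_quad_cone_nonzero: "AE x in quad_cone_measure \<gamma>. x \<noteq> 0"
proof -
  have "{0} \<in> null_sets (quad_cone_measure \<gamma> :: ('a \<times> 'b) measure)"
  proof (rule null_setsI)
    have 0: "{0} \<subseteq> (quad_cone \<gamma> :: ('a \<times> 'b) set)" by (simp add: quad_cone_def zero_prod_def)
    show "emeasure (quad_cone_measure \<gamma> :: ('a \<times> 'b) measure) {0} = 0"
      using 0 DIM_positive[where 'a='a] DIM_positive[where 'a='b]
      by (subst emeasure_quad_cone_measure) (auto intro!: hausdorff_outer_singleton simp del: DIM_positive)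
    show "{0} \<in> sets (quad_cone_measure \<gamma> :: ('a \<times> 'b) measure)"
      using 0 by (simp add: sets_quad_cone_measure)
  qed
  from AE_not_in[OF this] show ?thesis by simp
qed

section \<open>Strict stability\<close>

text \<open>
  \<open>N\<close> is the dimension of the ambient space, so the cone has dimension \<open>N - 1\<close>, and the constant in
  Hardy's inequality is \<open>((N - 3) / 2)\<^sup>2\<close>.
\<close>

lemma stability_form_quad_cone_ge:
  fixes \<phi> :: "'a::euclidean_space \<times> 'b::euclidean_space \<Rightarrow> real"
  assumes \<gamma>: "0 < \<gamma>" and minimal: "\<gamma>\<^sup>2 * (real DIM('a) - 1) = real DIM('b) - 1"
    and N: "N = real DIM('a) + real DIM('b)" "3 < N" and c: "c = ((N - 3) / 2)\<^sup>2 - (N - 2)" "0 \<le> c"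
    and R: "0 < R" and C1: "\<phi> \<in> C1_restrictions (quad_cone \<gamma>)"
    and cpt: "compactly_contained (support_in (quad_cone \<gamma>) \<phi>) (ball 0 R)"
  shows "c / R\<^sup>2 * hypersurface_integral (quad_cone \<gamma>) (\<lambda>x. (\<phi> x)\<^sup>2)
    \<le> stability_form (quad_cone \<gamma>) \<phi>"
proof -
  let ?M = "quad_cone \<gamma> :: ('a \<times> 'b) set" and ?\<mu> = "quad_cone_measure \<gamma> :: ('a \<times> 'b) measure"
  interpret cone_measure ?\<mu> "N - 1"
    using cone_measure_quad_cone[OF \<gamma>, where 'a='a and 'b='b] by (simp add: N)
  obtain \<Phi> D where \<Phi>: "\<And>x. GDERIV \<Phi> x :> D x" and D: "continuous_on UNIV D"
    and eq: "\<And>x. x \<in> ?M \<Longrightarrow> \<phi> x = \<Phi> x"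
    using C1 unfolding C1_restrictions_def by blast
  have \<Phi>_cont: "continuous_on UNIV \<Phi>"
    using \<Phi> by (intro continuous_at_imp_continuous_on) (auto simp: gderiv_def intro: has_derivative_continuous)
  have [measurable]: "\<Phi> \<in> borel_measurable borel" "D \<in> borel_measurable borel"
    "(normal_map \<gamma> :: 'a \<times> 'b \<Rightarrow> _) \<in> borel_measurable borel"
    using \<Phi>_cont D bounded_linear_normal_map[THEN linear_continuous_on]
    by (auto intro!: borel_measurable_continuous_onI)
  \<comment> \<open>on the cone without the origin, the squared length of the tangential gradient \<open>v x\<close>, in a form that is Borel measurable on the whole space\<close>
  define W where "W x = (norm (D x))\<^sup>2 - (D x \<bullet> normal_map \<gamma> x)\<^sup>2 / (norm x)\<^sup>2" for x
  have [measurable]: "W \<in> borel_measurable borel" unfolding W_def by measurable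
  define v where "v x = D x - (D x \<bullet> cone_normal \<gamma> x) *\<^sub>R cone_normal \<gamma> x" for x
  have v: "(norm (v x))\<^sup>2 = W x" "v x \<in> tangent_space ?M x" "v x \<bullet> D x = W x" "v x \<bullet> x = D x \<bullet> x"
    if x: "x \<in> ?M" "x \<noteq> 0" for x
  proof -
    let ?\<nu> = "cone_normal \<gamma> x"
    have \<nu>: "?\<nu> \<bullet> ?\<nu> = 1" using norm_cone_normal[OF \<gamma> x] by (simp add: dot_square_norm)
    have 1: "?\<nu> \<bullet> v x = 0" by (simp add: v_def inner_diff_right \<nu> inner_commute)
    then show "v x \<in> tangent_space ?M x" by (simp add: tangent_space_cone_normal[OF \<gamma> x])
    have "(D x \<bullet> ?\<nu>)\<^sup>2 = (D x \<bullet> normal_map \<gamma> x)\<^sup>2 / (norm x)\<^sup>2"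
      by (simp add: cone_normal_def power_mult_distrib power_inverse divide_inverse)
    moreover have "v x \<bullet> D x = (norm (D x))\<^sup>2 - (D x \<bullet> ?\<nu>)\<^sup>2"
      unfolding v_def power2_norm_eq_inner
      by (simp add: inner_diff_left inner_commute[of ?\<nu>] power2_eq_square)
    ultimately show 2: "v x \<bullet> D x = W x" by (simp add: W_def)
    have "v x \<bullet> v x = v x \<bullet> D x"
      using 1 by (subst (2) v_def) (simp add: inner_diff_right inner_commute)
    then show "(norm (v x))\<^sup>2 = W x" using 2 by (simp add: power2_norm_eq_inner)
    have "?\<nu> \<bullet> x = 0" using x \<gamma> by (simp add: cone_normal_orthogonal_iff quad_cone_iff[symmetric])
    then show "v x \<bullet> x = D x \<bullet> x" by (simp add: v_def inner_diff_left)
  qed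
  have W_nonneg: "0 \<le> W x" if "x \<in> ?M" for x
    using v(1)[OF that] by (cases "x = 0") (auto simp: W_def[of 0] simp del: zero_prod_def, metis zero_le_power2)
  define X where "X = {x\<in>?M. \<phi> x \<noteq> 0}"
  have X: "\<Phi> x = 0" if "x \<in> ?M" "x \<notin> closure X" for x
  proof -
    have "x \<notin> X" using that(2) closure_subset[of X] by (rule contra_subsetD[rotated])
    then show ?thesis using that(1) eq by (simp add: X_def)
  qed
  have outside: "x \<notin> closure X" if "x \<in> ?M" "R \<le> norm x" for x
  proof
    assume "x \<in> closure X"
    then have "x \<in> support_in ?M \<phi>" using that by (simp add: support_in_def X_def)
    then have "x \<in> ball 0 R" using cpt closure_subset unfolding compactly_contained_def by blast
    then show False using that by simp
  qed
  have \<Phi>_supp: "\<Phi> x = 0" if "x \<in> ?M" "R \<le> norm x" for x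
    using X outside that by simp
  \<comment> \<open>outside the support \<open>\<Phi>\<close> vanishes on the cone near \<open>x\<close>, although not necessarily off the cone\<close>
  have W_supp: "W x = 0" if x: "x \<in> ?M" "R \<le> norm x" for x
  proof -
    have nz: "x \<noteq> 0" using x R by auto
    have "open (- closure X)" "x \<in> - closure X" using outside[OF x] by auto
    then obtain e where e: "0 < e" "ball x e \<subseteq> - closure X"
      unfolding open_contains_ball by metis
    have zero: "\<Phi> y = 0" if "y \<in> ?M" "dist y x < e" for y
    proof -
      have "y \<in> ball x e" using that by (simp add: dist_commute)
      from subsetD[OF e(2) this] show ?thesis using that X by simp
    qed
    have "(\<Phi> has_derivative (\<lambda>_. 0)) (at x within ?M)"
      by (rule has_derivative_transform_within[OF has_derivative_const e(1) x(1)]) (simp add: zero)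
    moreover have "(\<Phi> has_derivative (\<lambda>h. h \<bullet> D x)) (at x within ?M)"
      using \<Phi>[of x] by (auto simp: gderiv_def intro: has_derivative_at_withinI)
    ultimately have "v x \<bullet> D x = 0"
      using has_derivative_within_tangent_unique[OF _ _ v(2)[OF x(1) nz]] by metis
    then show ?thesis using v(3)[OF x(1) nz] by simp
  qed
  have "compact (D ` cball 0 R)" "compact (\<Phi> ` cball 0 R)"
    by (intro compact_continuous_image continuous_on_subset[OF D] continuous_on_subset[OF \<Phi>_cont]; simp)+
  then obtain C C' where C: "\<forall>x\<in>cball 0 R. norm (D x) \<le> C" and C': "\<forall>x\<in>cball 0 R. \<bar>\<Phi> x\<bar> \<le> C'"
    by (auto dest!: compact_imp_bounded simp: bounded_iff)
  have W_int: "integrable ?\<mu> W"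
  proof (rule integrable_bounded_support[of _ R "C\<^sup>2"])
    fix x assume x: "x \<in> space ?\<mu>" "norm x \<le> R"
    have "W x \<le> (norm (D x))\<^sup>2" by (simp add: W_def)
    also have "\<dots> \<le> C\<^sup>2" using C x by (intro power_mono) auto
    finally show "\<bar>W x\<bar> \<le> C\<^sup>2" using W_nonneg x by simp
  qed (use W_supp in \<open>auto intro!: measurable_cone\<close>)
  have \<Phi>_int: "integrable ?\<mu> (\<lambda>x. (\<Phi> x)\<^sup>2)"
  proof (rule integrable_bounded_support[of _ R "C'\<^sup>2"])
    show "\<bar>(\<Phi> x)\<^sup>2\<bar> \<le> C'\<^sup>2" if "norm x \<le> R" for x
      using C' that power_mono[of "\<bar>\<Phi> x\<bar>" C' 2] by simp
  qed (use \<Phi>_supp in \<open>auto intro!: measurable_cone\<close>)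
  have W_ge: "(D x \<bullet> x)\<^sup>2 \<le> (norm x)\<^sup>2 * W x" if "x \<in> space ?\<mu>" for x
  proof (cases "x = 0")
    case False
    have "\<bar>v x \<bullet> x\<bar> \<le> norm (v x) * norm x" by (rule Cauchy_Schwarz_ineq2)
    then have "(v x \<bullet> x)\<^sup>2 \<le> (norm (v x) * norm x)\<^sup>2" by (metis abs_ge_zero power2_abs power_mono)
    then show ?thesis using v[of x] that False by (simp add: power_mult_distrib mult.commute)
  qed simp
  have N4: "2 < N - 1" using N(2) by simp
  note hardy = hardy[OF N4 AE_quad_cone_nonzero \<Phi> D _ W_int _ W_ge, of R]
  have h_int: "integrable ?\<mu> (\<lambda>x. (\<Phi> x)\<^sup>2 / (norm x)\<^sup>2)"
    by (rule hardy(1)) (simp_all add: \<Phi>_supp W_nonneg)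
  have h_le: "((N - 1 - 2) / 2)\<^sup>2 * (\<integral>x. (\<Phi> x)\<^sup>2 / (norm x)\<^sup>2 \<partial>?\<mu>) \<le> (\<integral>x. W x \<partial>?\<mu>)"
    by (rule hardy(2)) (simp_all add: \<Phi>_supp W_nonneg)
  define f where "f x = (norm (tangential_gradient ?M \<phi> x))\<^sup>2
      - second_fundamental_form_norm_sq ?M x * (\<phi> x)\<^sup>2" for x
  define F where "F x = W x - (N - 2) * ((\<Phi> x)\<^sup>2 / (norm x)\<^sup>2)" for x
  have [measurable]: "F \<in> borel_measurable borel" unfolding F_def by measurable
  have fF: "f x = F x" if "x \<in> ?M" "x \<noteq> 0" for x
    using tangential_gradient_quad_cone[OF \<gamma> that \<Phi> eq] v(1)[OF that] that
    by (simp add: f_def F_def v_def[symmetric] second_fundamental_form_norm_sq_quad_cone[OF \<gamma> that minimal] eq N)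
  \<comment> \<open>at the origin the tangential gradient and the second fundamental form have no meaningful value\<close>
  have f_meas: "f \<in> borel_measurable ?\<mu>"
  proof (subst measurable_cong)
    show "f x = (if x = 0 then f 0 else F x)" if "x \<in> space ?\<mu>" for x using fF that by auto
    show "(\<lambda>x. if x = 0 then f 0 else F x) \<in> borel_measurable ?\<mu>" by (rule measurable_cone) measurable
  qed
  have "c / R\<^sup>2 * hypersurface_integral ?M (\<lambda>x. (\<phi> x)\<^sup>2) = c * (\<integral>x. (\<Phi> x)\<^sup>2 / R\<^sup>2 \<partial>?\<mu>)"
  proof -
    have "(\<integral>x. (\<phi> x)\<^sup>2 \<partial>?\<mu>) = (\<integral>x. (\<Phi> x)\<^sup>2 \<partial>?\<mu>)"
      by (rule Bochner_Integration.integral_cong) (simp_all add: eq)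
    then show ?thesis unfolding hypersurface_integral_quad_cone by simp
  qed
  also have "\<dots> \<le> c * (\<integral>x. (\<Phi> x)\<^sup>2 / (norm x)\<^sup>2 \<partial>?\<mu>)"
  proof (intro mult_left_mono c integral_mono_AE h_int)
    show "integrable ?\<mu> (\<lambda>x. (\<Phi> x)\<^sup>2 / R\<^sup>2)" using \<Phi>_int by simp
    show "AE x in ?\<mu>. (\<Phi> x)\<^sup>2 / R\<^sup>2 \<le> (\<Phi> x)\<^sup>2 / (norm x)\<^sup>2"
      using AE_quad_cone_nonzero AE_space
    proof eventually_elim
      case (elim x)
      show ?case
      proof (cases "R \<le> norm x")
        case True then show ?thesis using \<Phi>_supp elim by simp
      next
        case False then show ?thesis
          using elim R by (intro divide_left_mono power_mono mult_pos_pos) auto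
      qed
    qed
  qed
  also have "\<dots> \<le> (\<integral>x. W x \<partial>?\<mu>) - (N - 2) * (\<integral>x. (\<Phi> x)\<^sup>2 / (norm x)\<^sup>2 \<partial>?\<mu>)"
    using h_le by (simp add: c(1) left_diff_distrib)
  also have "\<dots> = (\<integral>x. F x \<partial>?\<mu>)"
  proof -
    have "integrable ?\<mu> (\<lambda>x. (N - 2) * ((\<Phi> x)\<^sup>2 / (norm x)\<^sup>2))"
      using h_int by (rule integrable_mult_right)
    from Bochner_Integration.integral_diff[OF W_int this] show ?thesis
      unfolding F_def by (simp only: integral_mult_right_zero)
  qed
  also have "\<dots> = (\<integral>x. f x \<partial>?\<mu>)"
  proof (rule integral_cong_AE)
    show "AE x in ?\<mu>. F x = f x"
      using AE_quad_cone_nonzero AE_space by eventually_elim (simp add: fF)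
  qed (use f_meas in \<open>auto intro!: measurable_cone\<close>)
  also have "\<dots> = stability_form ?M \<phi>"
    unfolding stability_form_def hypersurface_integral_quad_cone f_def ..
  finally show ?thesis .
qed

lemma lawson_cone_eq_quad_cone:
  assumes "2 \<le> CARD('k::finite)" "2 \<le> CARD('h::finite)"
  shows "(lawson_cone :: ((real^'k) \<times> (real^'h)) set)
    = quad_cone (sqrt ((real CARD('h) - 1) / (real CARD('k) - 1)))"
  using assms by (auto simp: lawson_cone_def quad_cone_def real_sqrt_divide field_simps)

theorem theorem2:
  fixes R :: real
  assumes "(CARD('h::finite), CARD('k::finite)) \<in> admissible_pairs \<or>
           (CARD('k), CARD('h)) \<in> admissible_pairs"
    and "R > 0"
  shows "first_eigenvalue (lawson_cone :: ((real^'k) \<times> (real^'h)) set) R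
           \<ge> ereal (stability_const CARD('k) CARD('h) / R\<^sup>2)"
proof -
  define k h where "k = real CARD('k)" and "h = real CARD('h)"
  define \<gamma> where "\<gamma> = sqrt ((h - 1) / (k - 1))"
  define N where "N = k + h"
  define c where "c = ((N - 3) / 2)\<^sup>2 - (N - 2)"
  have card: "2 \<le> CARD('k)" "2 \<le> CARD('h)"
    using assms(1) by (auto simp: admissible_pairs_def)
  have N: "8 \<le> N" using assms(1) by (auto simp: admissible_pairs_def N_def k_def h_def)
  have "c - 1 / 4 = (N - 8) * (N - 2) / 4" by (simp add: c_def power2_eq_square field_simps)
  also have "0 \<le> \<dots>" using N by simp
  finally have c: "1 / 4 \<le> c" by simp
  have "sqrt 3 \<le> 2" "sqrt 11 \<le> 4" by (simp_all add: real_sqrt_le_iff' real_le_lsqrt)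
  then have const: "stability_const CARD('k) CARD('h) \<le> c"
    using c by (auto simp: stability_const_def)
  have \<gamma>: "0 < \<gamma>" "\<gamma>\<^sup>2 * (k - 1) = h - 1" using card by (simp_all add: \<gamma>_def k_def h_def)
  let ?M = "lawson_cone :: ((real^'k) \<times> (real^'h)) set"
  have M: "?M = quad_cone \<gamma>"
    using lawson_cone_eq_quad_cone[OF card] by (simp add: \<gamma>_def k_def h_def)
  show ?thesis
    unfolding first_eigenvalue_def
  proof (rule INF_greatest, clarify)
    fix \<phi> assume \<phi>: "\<phi> \<in> C1_restrictions ?M" "hypersurface_integral ?M (\<lambda>x. (\<phi> x)\<^sup>2) = 1"
      "compactly_contained (support_in ?M \<phi>) (ball 0 R)"
    have "stability_const CARD('k) CARD('h) / R\<^sup>2 \<le> c / R\<^sup>2"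
      using const by (rule divide_right_mono) simp
    also have "\<dots> = c / R\<^sup>2 * hypersurface_integral ?M (\<lambda>x. (\<phi> x)\<^sup>2)" using \<phi>(2) by simp
    also have "\<dots> \<le> stability_form ?M \<phi>"
      unfolding M
    proof (rule stability_form_quad_cone_ge[OF \<gamma>(1) _ _ _ c_def])
      show "\<gamma>\<^sup>2 * (real DIM(real^'k) - 1) = real DIM(real^'h) - 1" using \<gamma>(2) by (simp add: k_def h_def)
      show "N = real DIM(real^'k) + real DIM(real^'h)" by (simp add: N_def k_def h_def)
    qed (use N c assms(2) \<phi> in \<open>auto simp: M\<close>)
    finally show "ereal (stability_const CARD('k) CARD('h) / R\<^sup>2) \<le> ereal (stability_form ?M \<phi>)"
      by simp
  qed
qed

end
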